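(* Let $d\geq 1$ be an integer and let $\Phi:\mathbb C^{d\times d}\to\mathbb C^{d\times d}$ be a complex-linear map which is 2-positive and trace-preserving. Then $$\mathrm{tr}(\Phi)\leq d\,\min\Re(\sigma(\Phi))+(d^2-d).$$
   Context: $\mathbb C^{d\times d}$ is the space of complex $d\times d$ matrices. A linear map $\Phi:\mathbb C^{d\times d}\to\mathbb C^{d\times d}$ is positive if $\Phi(A)$ is positive semi-definite whenever $A$ is positive semi-definite. It is 2-positive if the extended map $\mathrm{id}_2\otimes\Phi:\mathbb C^{2\times 2}\otimes\mathbb C^{d\times d}\to\mathbb C^{2\times 2}\otimes\mathbb C^{d\times d}$, determined by $(\mathrm{id}_2\otimes\Phi)(A\otimes B)=A\otimes\Phi(B)$, is positive (sends positive semi-definite matrices to positive semi-definite matrices). It is trace-preserving if $\mathrm{tr}(\Phi(X))=\mathrm{tr}(X)$ for all $X\in\mathbb C^{d\times d}$. Here $\mathrm{tr}(\Phi)$ is the trace of $\Phi$ as a linear operator on the $d^2$-dimensional complex vector space $\mathbb C^{d\times d}$ (it is a real number for every positive $\Phi$), $\sigma(\Phi)$ is the spectrum (set of eigenvalues) of $\Phi$ as such an operator, and $\min\Re(\sigma(\Phi))$ is the smallest real part of any eigenvalue of $\Phi$. *)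

theory Defs
  imports "Jordan_Normal_Form.Schur_Decomposition"
begin

definition mat_trace :: "complex mat \<Rightarrow> complex" where
  "mat_trace A = (\<Sum>i<dim_row A. A $$ (i, i))"

text \<open>The scalar product \<open>(A *\<^sub>v v) \<bullet>c v\<close> conjugates its second argument, so it is $v^* A v$.\<close>

definition pos_semidef :: "nat \<Rightarrow> complex mat \<Rightarrow> bool" where
  "pos_semidef n A \<longleftrightarrow> A \<in> carrier_mat n n \<and> mat_adjoint A = A \<and>
     (\<forall>v \<in> carrier_vec n. 0 \<le> Re ((A *\<^sub>v v) \<bullet>c v))"

text \<open>Superoperators on $n \times n$ matrices are functions on \<^typ>\<open>complex mat\<close>
  of which only the restriction to \<^term>\<open>carrier_mat n n\<close> matters.\<close>

definition linear_superop :: "nat \<Rightarrow> (complex mat \<Rightarrow> complex mat) \<Rightarrow> bool" where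
  "linear_superop n \<Phi> \<longleftrightarrow>
     \<Phi> \<in> carrier_mat n n \<rightarrow> carrier_mat n n \<and>
     (\<forall>A \<in> carrier_mat n n. \<forall>B \<in> carrier_mat n n. \<Phi> (A + B) = \<Phi> A + \<Phi> B) \<and>
     (\<forall>c. \<forall>A \<in> carrier_mat n n. \<Phi> (c \<cdot>\<^sub>m A) = c \<cdot>\<^sub>m \<Phi> A)"

definition positive_superop :: "nat \<Rightarrow> (complex mat \<Rightarrow> complex mat) \<Rightarrow> bool" where
  "positive_superop n \<Phi> \<longleftrightarrow> (\<forall>A. pos_semidef n A \<longrightarrow> pos_semidef n (\<Phi> A))"

definition kronecker :: "complex mat \<Rightarrow> complex mat \<Rightarrow> complex mat" where
  "kronecker A B = mat (dim_row A * dim_row B) (dim_col A * dim_col B)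
     (\<lambda>(p, q). A $$ (p div dim_row B, q div dim_col B) * B $$ (p mod dim_row B, q mod dim_col B))"

definition mat_block :: "nat \<Rightarrow> complex mat \<Rightarrow> nat \<Rightarrow> nat \<Rightarrow> complex mat" where
  "mat_block d M a b = mat d d (\<lambda>(i, j). M $$ (a * d + i, b * d + j))"

text \<open>The map $\mathrm{id}_k \otimes \Phi$ under the identification of
  $\mathbb C^{k\times k}\otimes\mathbb C^{d\times d}$ with the $kd \times kd$ matrices given by
  \<^const>\<open>kronecker\<close>: it applies $\Phi$ to each of the $k^2$ blocks of size $d \times d$.
  The lemmas \<open>linear_superop_id_tensor\<close> and \<open>id_tensor_kronecker\<close> below show that it is
  linear and has the values on elementary tensors that determine $\mathrm{id}_k \otimes \Phi$.\<close>

definition id_tensor :: "nat \<Rightarrow> nat \<Rightarrow> (complex mat \<Rightarrow> complex mat) \<Rightarrow> complex mat \<Rightarrow> complex mat" where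
  "id_tensor k d \<Phi> M = mat (k * d) (k * d)
     (\<lambda>(p, q). \<Phi> (mat_block d M (p div d) (q div d)) $$ (p mod d, q mod d))"

definition two_positive :: "nat \<Rightarrow> (complex mat \<Rightarrow> complex mat) \<Rightarrow> bool" where
  "two_positive d \<Phi> \<longleftrightarrow> positive_superop (2 * d) (id_tensor 2 d \<Phi>)"

definition trace_preserving :: "nat \<Rightarrow> (complex mat \<Rightarrow> complex mat) \<Rightarrow> bool" where
  "trace_preserving d \<Phi> \<longleftrightarrow> (\<forall>X \<in> carrier_mat d d. mat_trace (\<Phi> X) = mat_trace X)"

definition matrix_unit :: "nat \<Rightarrow> nat \<Rightarrow> nat \<Rightarrow> complex mat" where
  "matrix_unit d i j = mat d d (\<lambda>(k, l). if k = i \<and> l = j then 1 else 0)"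

text \<open>The trace of $\Phi$ on the $d^2$-dimensional space of matrices, computed in the basis of
  matrix units $E_{ij}$: the coefficient of $\Phi(E_{ij})$ at $E_{ij}$ is its $(i,j)$ entry.\<close>

definition superop_trace :: "nat \<Rightarrow> (complex mat \<Rightarrow> complex mat) \<Rightarrow> complex" where
  "superop_trace d \<Phi> = (\<Sum>i<d. \<Sum>j<d. \<Phi> (matrix_unit d i j) $$ (i, j))"

definition superop_spectrum :: "nat \<Rightarrow> (complex mat \<Rightarrow> complex mat) \<Rightarrow> complex set" where
  "superop_spectrum d \<Phi> = {\<mu>. \<exists>X \<in> carrier_mat d d. X \<noteq> 0\<^sub>m d d \<and> \<Phi> X = \<mu> \<cdot>\<^sub>m X}"

lemma block_index_less:
  fixes a i k d :: nat
  assumes "a < k" "i < d"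
  shows "a * d + i < k * d"
proof -
  have "a * d + i < Suc a * d" using assms(2) by simp
  also have "\<dots> \<le> k * d" using assms(1) by (intro mult_le_mono1) simp
  finally show ?thesis .
qed

lemma mat_block_carrier [simp]: "mat_block d M a b \<in> carrier_mat d d"
  by (simp add: mat_block_def)

lemma linear_superop_id_tensor:
  assumes "linear_superop d \<Phi>"
  shows "linear_superop (k * d) (id_tensor k d \<Phi>)"
proof -
  have car: "\<Phi> A \<in> carrier_mat d d" if "A \<in> carrier_mat d d" for A
    using assms that by (auto simp: linear_superop_def)
  have add: "\<Phi> (A + B) = \<Phi> A + \<Phi> B" if "A \<in> carrier_mat d d" "B \<in> carrier_mat d d" for A B
    using assms that by (auto simp: linear_superop_def)
  have sm: "\<Phi> (c \<cdot>\<^sub>m A) = c \<cdot>\<^sub>m \<Phi> A" if "A \<in> carrier_mat d d" for c A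
    using assms that by (auto simp: linear_superop_def)
  have dims: "dim_row (\<Phi> (mat_block d M a b)) = d" "dim_col (\<Phi> (mat_block d M a b)) = d" for M a b
    using car[OF mat_block_carrier] by auto
  have idx: "p div d < k \<and> p mod d < d" if "p < k * d" for p
    using that by (cases "d = 0") (auto simp: less_mult_imp_div_less)
  have badd: "mat_block d (A + B) a b = mat_block d A a b + mat_block d B a b"
    if "A \<in> carrier_mat (k * d) (k * d)" "B \<in> carrier_mat (k * d) (k * d)" "a < k" "b < k" for A B a b
    using that by (intro eq_matI) (auto simp: mat_block_def block_index_less)
  have bsm: "mat_block d (c \<cdot>\<^sub>m A) a b = c \<cdot>\<^sub>m mat_block d A a b"
    if "A \<in> carrier_mat (k * d) (k * d)" "a < k" "b < k" for A c a b
    using that by (intro eq_matI) (auto simp: mat_block_def block_index_less)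
  show ?thesis
    unfolding linear_superop_def
  proof (intro conjI ballI allI)
    show "id_tensor k d \<Phi> \<in> carrier_mat (k * d) (k * d) \<rightarrow> carrier_mat (k * d) (k * d)"
      by (simp add: id_tensor_def)
  next
    fix A B :: "complex mat"
    assume AB: "A \<in> carrier_mat (k * d) (k * d)" "B \<in> carrier_mat (k * d) (k * d)"
    show "id_tensor k d \<Phi> (A + B) = id_tensor k d \<Phi> A + id_tensor k d \<Phi> B"
      using AB idx by (intro eq_matI) (auto simp: id_tensor_def badd add dims)
  next
    fix c and A :: "complex mat"
    assume A: "A \<in> carrier_mat (k * d) (k * d)"
    show "id_tensor k d \<Phi> (c \<cdot>\<^sub>m A) = c \<cdot>\<^sub>m id_tensor k d \<Phi> A"
      using A idx by (intro eq_matI) (auto simp: id_tensor_def bsm sm dims)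
  qed
qed

lemma id_tensor_kronecker:
  assumes "linear_superop d \<Phi>" "A \<in> carrier_mat k k" "B \<in> carrier_mat d d"
  shows "id_tensor k d \<Phi> (kronecker A B) = kronecker A (\<Phi> B)"
proof -
  have car: "\<Phi> B \<in> carrier_mat d d"
    using assms by (auto simp: linear_superop_def)
  have sm: "\<Phi> (c \<cdot>\<^sub>m B) = c \<cdot>\<^sub>m \<Phi> B" for c
    using assms by (auto simp: linear_superop_def)
  have idx: "p div d < k \<and> p mod d < d" if "p < k * d" for p
    using that by (cases "d = 0") (auto simp: less_mult_imp_div_less)
  have blk: "mat_block d (kronecker A B) a b = A $$ (a, b) \<cdot>\<^sub>m B" if "a < k" "b < k" for a b
    using that assms(2,3)
    by (intro eq_matI) (auto simp: mat_block_def kronecker_def block_index_less)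
  show ?thesis
    using assms(2) car idx
    by (intro eq_matI) (auto simp: id_tensor_def blk sm kronecker_def[of A "\<Phi> B"])
qed

end

theory Submission
  imports "HOL-Analysis.Function_Topology" "HOL-Analysis.Topology_Euclidean_Space"
    "Jordan_Normal_Form.Spectral_Radius" Defs
begin

text \<open>Let $\Phi X = \mu X$ with $X$ of operator norm $1$, attained as $Xv = u$, $X^*u = v$ for unit
  vectors; multiplying $X$ by a phase makes $\langle u, v\rangle$ real and nonnegative. The matrix
  $[[1-uu^*, X-uv^*], [X^*-vu^*, 1-vv^*]]$ is positive semi-definite, so
  applying $\mathrm{id}_2\otimes\Phi$ and pairing with $(u,v)$ gives
  $\Re\mu \ge \Re\langle u,\Phi(uv^*)v\rangle - \frac12\langle u,\Phi(1-uu^*)u\rangle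
  - \frac12\langle v,\Phi(1-vv^*)v\rangle$.
  In an orthonormal basis with $u = cf_0+sf_1$, $v = cf_0-sf_1$ both this bound and the trace of
  $\Phi$ involve only the numbers $p_{ij} = \langle f_i,\Phi(f_jf_j^*)f_i\rangle$ and
  $q_{ij} = \Re\langle f_i,\Phi(f_if_j^*)f_j\rangle$. Testing 2-positivity on
  $f_if_i^* - f_jf_j^*$ and, averaged over phases, on
  $f_0f_0^* + (f_1-\sqrt2\,\omega f_j)(f_1+\sqrt2\,\omega f_j)^*$ gives enough linear inequalities
  between them to conclude.\<close>

section \<open>Linear algebra of coordinate vectors\<close>

text \<open>Vectors of $\mathbb C^d$ are functions on the naturals of which only the values at indices
  below $d$ matter.\<close>

definition lincomb :: "complex \<Rightarrow> (nat \<Rightarrow> complex) \<Rightarrow> complex \<Rightarrow> (nat \<Rightarrow> complex) \<Rightarrow> nat \<Rightarrow> complex" where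
  "lincomb a x b y = (\<lambda>i. a * x i + b * y i)"

definition cinner :: "nat \<Rightarrow> (nat \<Rightarrow> complex) \<Rightarrow> (nat \<Rightarrow> complex) \<Rightarrow> complex" where
  "cinner d x y = (\<Sum>i<d. cnj (x i) * y i)"

definition sqnorm :: "nat \<Rightarrow> (nat \<Rightarrow> complex) \<Rightarrow> real" where
  "sqnorm d x = (\<Sum>i<d. (cmod (x i))\<^sup>2)"

definition mat_app :: "nat \<Rightarrow> complex mat \<Rightarrow> (nat \<Rightarrow> complex) \<Rightarrow> nat \<Rightarrow> complex" where
  "mat_app d A x = (\<lambda>k. \<Sum>i<d. A $$ (k, i) * x i)"

definition adj_app :: "nat \<Rightarrow> complex mat \<Rightarrow> (nat \<Rightarrow> complex) \<Rightarrow> nat \<Rightarrow> complex" where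
  "adj_app d A x = (\<lambda>k. \<Sum>i<d. cnj (A $$ (i, k)) * x i)"

definition orthonormal :: "nat \<Rightarrow> nat \<Rightarrow> (nat \<Rightarrow> nat \<Rightarrow> complex) \<Rightarrow> bool" where
  "orthonormal d m f \<longleftrightarrow> (\<forall>i<m. \<forall>j<m. cinner d (f i) (f j) = (if i = j then 1 else 0))"

lemma cinner_cong:
  assumes "\<And>i. i < d \<Longrightarrow> x i = x' i" "\<And>i. i < d \<Longrightarrow> y i = y' i"
  shows "cinner d x y = cinner d x' y'"
  unfolding cinner_def by (rule sum.cong) (auto simp: assms)

lemma cinner_lincomb_right:
  "cinner d x (lincomb a y b z) = a * cinner d x y + b * cinner d x z"
  by (simp add: cinner_def lincomb_def sum.distrib sum_distrib_left algebra_simps)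

lemma cinner_lincomb_left:
  "cinner d (lincomb a y b z) x = cnj a * cinner d y x + cnj b * cinner d z x"
  by (simp add: cinner_def lincomb_def sum.distrib sum_distrib_left algebra_simps)

lemma cnj_cinner: "cnj (cinner d x y) = cinner d y x"
  by (simp add: cinner_def mult.commute)

lemma cinner_self: "cinner d x x = of_real (sqnorm d x)"
  unfolding cinner_def sqnorm_def of_real_sum
  by (rule sum.cong) (simp_all add: complex_norm_square[symmetric] mult.commute[of "cnj _"])

lemma sqnorm_nonneg: "0 \<le> sqnorm d x"
  by (simp add: sqnorm_def sum_nonneg)

lemma sqnorm_eq_0: "sqnorm d x = 0 \<longleftrightarrow> (\<forall>i<d. x i = 0)"
  by (auto simp: sqnorm_def sum_nonneg_eq_0_iff)

lemma sqnorm_lincomb: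
  "sqnorm d (lincomb a x b y) =
     (cmod a)\<^sup>2 * sqnorm d x + (cmod b)\<^sup>2 * sqnorm d y + 2 * Re (cnj a * b * cinner d x y)"
proof -
  have "complex_of_real (sqnorm d (lincomb a x b y)) =
      cnj a * a * of_real (sqnorm d x) + cnj b * b * of_real (sqnorm d y) +
      (cnj a * b * cinner d x y + cnj (cnj a * b * cinner d x y))"
    by (simp add: cinner_self[symmetric] cinner_lincomb_left cinner_lincomb_right cnj_cinner
        algebra_simps)
  also have "\<dots> = of_real ((cmod a)\<^sup>2 * sqnorm d x + (cmod b)\<^sup>2 * sqnorm d y
      + 2 * Re (cnj a * b * cinner d x y))"
    unfolding complex_add_cnj of_real_add of_real_mult complex_norm_square
    by (simp add: mult.commute)
  finally show ?thesis by (simp only: of_real_eq_iff)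
qed

text \<open>Expand the squared norm of s y - z x, where s = \<open>sqnorm d x\<close> and z =
  \<open>cinner d x y\<close>: it equals s (s |y|^2 - |z|^2), and s can be cancelled unless it is
  0.\<close>

lemma cinner_Cauchy_Schwarz: "(cmod (cinner d x y))\<^sup>2 \<le> sqnorm d x * sqnorm d y"
proof (cases "sqnorm d x = 0")
  case True
  then have "cinner d x y = 0" by (simp add: sqnorm_eq_0 cinner_def)
  then show ?thesis by (simp add: True)
next
  case False
  let ?z = "cinner d x y" and ?s = "sqnorm d x"
  have pos: "?s > 0" using False sqnorm_nonneg[of d x] by simp
  have "0 \<le> sqnorm d (lincomb (- ?z) x (of_real ?s) y)" by (rule sqnorm_nonneg)
  also have "\<dots> = ?s * (?s * sqnorm d y - (cmod ?z)\<^sup>2)"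
  proof -
    have "Re (cnj (- ?z) * of_real ?s * ?z) = - (?s * (cmod ?z)\<^sup>2)"
    proof -
      have "cnj (- ?z) * of_real ?s * ?z = of_real (- ?s) * (?z * cnj ?z)" by simp
      also have "\<dots> = of_real (- ?s * (cmod ?z)\<^sup>2)"
        by (simp add: complex_norm_square[symmetric])
      finally show ?thesis by (simp only: Re_complex_of_real)
    qed
    then show ?thesis
      by (simp add: sqnorm_lincomb power2_eq_square algebra_simps)
  qed
  finally show ?thesis using pos by (simp add: zero_le_mult_iff)
qed

lemma cinner_mat_app: "cinner d x (mat_app d A y) = cinner d (adj_app d A x) y"
proof -
  have "cinner d x (mat_app d A y) = (\<Sum>k<d. \<Sum>i<d. cnj (x k) * A $$ (k, i) * y i)"
    by (simp add: cinner_def mat_app_def sum_distrib_left algebra_simps)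
  also have "\<dots> = (\<Sum>i<d. \<Sum>k<d. cnj (x k) * A $$ (k, i) * y i)" by (rule sum.swap)
  also have "\<dots> = cinner d (adj_app d A x) y"
    by (simp add: cinner_def adj_app_def sum_distrib_right sum_distrib_left algebra_simps)
  finally show ?thesis .
qed

section \<open>Orthonormal systems\<close>

lemma orthonormal_step:
  assumes f: "orthonormal d m f" and m: "m < d"
  shows "\<exists>g. orthonormal d (Suc m) g \<and> (\<forall>i<m. g i = f i)"
proof -
  \<comment> \<open>The rows are the conjugates of the given vectors, padded with zero rows. As m <
    d, row m is zero, so the determinant vanishes and a kernel vector of \<open>A\<close> is
    orthogonal to every \<open>f i\<close> with i < m.\<close>
  define A where "A = mat d d (\<lambda>(i, j). if i < m then cnj (f i j) else 0)"
  have A: "A \<in> carrier_mat d d" by (simp add: A_def)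
  have "A = mat\<^sub>r d d (\<lambda>i. if i = m then 0\<^sub>v d else row A i)"
    by (intro eq_matI) (auto simp: A_def)
  moreover have "det (mat\<^sub>r d d (\<lambda>i. if i = m then 0\<^sub>v d else row A i)) = 0"
    by (rule det_row_0[OF m]) (auto simp: A_def)
  ultimately have "det A = 0" by simp
  then obtain w where w: "w \<in> carrier_vec d" "w \<noteq> 0\<^sub>v d" "A *\<^sub>v w = 0\<^sub>v d"
    using det_0_iff_vec_prod_zero[OF A] by blast
  let ?w = "\<lambda>i. w $ i"
  have orth: "cinner d (f i) ?w = 0" if "i < m" for i
  proof -
    have "(A *\<^sub>v w) $ i = 0" using w(3) that m by simp
    then show ?thesis
      using that m w(1) by (simp add: A_def scalar_prod_def cinner_def atLeast0LessThan)
  qed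
  have "sqnorm d ?w \<noteq> 0"
    using w(1,2) by (auto simp: sqnorm_eq_0)
  then have pos: "sqnorm d ?w > 0" using sqnorm_nonneg[of d ?w] by simp
  define e where "e = lincomb (1 / of_real (sqrt (sqnorm d ?w))) ?w 0 ?w"
  have e1: "cinner d e e = 1"
    using pos by (simp add: e_def cinner_self sqnorm_lincomb norm_divide power_divide)
  have e2: "cinner d (f i) e = 0" "cinner d e (f i) = 0" if "i < m" for i
    using orth[OF that] cnj_cinner[of d "f i" ?w]
    by (auto simp: e_def cinner_lincomb_right cinner_lincomb_left)
  have "orthonormal d (Suc m) (f(m := e))"
    using f e1 e2 by (auto simp: orthonormal_def less_Suc_eq)
  then show ?thesis by (intro exI[of _ "f(m := e)"]) auto
qed

lemma orthonormal_extend: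
  assumes "orthonormal d m f" "m \<le> d"
  shows "\<exists>g. orthonormal d d g \<and> (\<forall>i<m. g i = f i)"
  using assms(2,1)
proof (induction m arbitrary: f rule: inc_induct)
  case base
  then show ?case by blast
next
  case (step m)
  obtain g where g: "orthonormal d (Suc m) g" "\<forall>i<m. g i = f i"
    using orthonormal_step step.hyps step.prems by blast
  obtain h where "orthonormal d d h" "\<forall>i<Suc m. h i = g i" using step.IH[OF g(1)] by blast
  then show ?case using g(2) by (intro exI[of _ h]) auto
qed

text \<open>Orthonormality says \<open>U * V = 1\<^sub>m d\<close> for square matrices, so
  \<open>V * U = 1\<^sub>m d\<close> as well; the entries of the latter are the completeness
  relation.\<close>

lemma orthonormal_complete:
  assumes f: "orthonormal d d f" and ab: "a < d" "b < d"
  shows "(\<Sum>i<d. f i a * cnj (f i b)) = (if a = b then 1 else 0)"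
proof -
  define U V where "U = mat d d (\<lambda>(i, j). cnj (f i j))" and "V = mat d d (\<lambda>(i, j). f j i)"
  have UV: "U \<in> carrier_mat d d" "V \<in> carrier_mat d d" by (auto simp: U_def V_def)
  have "U * V = 1\<^sub>m d"
    using f by (intro eq_matI)
      (auto simp: U_def V_def scalar_prod_def orthonormal_def cinner_def atLeast0LessThan)
  then have "V * U = 1\<^sub>m d" using mat_mult_left_right_inverse UV by blast
  then have "(V * U) $$ (a, b) = (if a = b then 1 else 0)" using ab by simp
  then show ?thesis
    using ab by (simp add: U_def V_def scalar_prod_def atLeast0LessThan)
qed

section \<open>Compactness and the top singular pair\<close>

lemma compact_unit_sphere:
  "compact {y :: nat \<Rightarrow> complex. (\<forall>i\<ge>d. y i = 0) \<and> sqnorm d y = 1}"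
proof -
  \<comment> \<open>Coordinates from d on are pinned to 0, so the sphere is a closed subset of a
    product of compact sets, which is compact by Tychonoff. Only finitely many coordinates enter
    \<open>sqnorm d\<close>, hence its continuity.\<close>
  let ?B = "PiE UNIV (\<lambda>i. if i < d then cball 0 1 else {0}) :: (nat \<Rightarrow> complex) set"
  have "compactin (product_topology (\<lambda>i. euclidean) UNIV) ?B"
    by (subst compactin_PiE) auto
  then have B: "compact ?B" by (simp add: euclidean_product_topology)
  have cont: "continuous_on UNIV (sqnorm d)"
    unfolding sqnorm_def by (intro continuous_intros continuous_on_product_coordinates)
  have "closed {y. sqnorm d y = 1}"
    using continuous_closed_preimage_constant[OF cont] by simp
  moreover have "{y. (\<forall>i\<ge>d. y i = 0) \<and> sqnorm d y = 1} = ?B \<inter> {y. sqnorm d y = 1}"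
  proof -
    have "cmod (y i) \<le> 1" if "sqnorm d y = 1" "i < d" for y :: "nat \<Rightarrow> complex" and i
    proof -
      have "(cmod (y i))\<^sup>2 \<le> sqnorm d y"
        unfolding sqnorm_def by (rule member_le_sum) (use that in auto)
      then show ?thesis using that(1) by (simp add: power2_le_iff_abs_le abs_square_le_1)
    qed
    then show ?thesis by (auto simp: PiE_iff split: if_splits)
  qed
  ultimately show ?thesis using compact_Int_closed[OF B] by metis
qed

lemma sqnorm_cong: "(\<And>i. i < d \<Longrightarrow> x i = y i) \<Longrightarrow> sqnorm d x = sqnorm d y"
  unfolding sqnorm_def by (rule sum.cong) auto

lemma sqnorm_scale: "sqnorm d (\<lambda>i. a * x i) = (cmod a)\<^sup>2 * sqnorm d x"
  by (simp add: sqnorm_def norm_mult power_mult_distrib sum_distrib_left)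

lemma mat_app_scale: "mat_app d A (\<lambda>i. a * x i) = (\<lambda>i. a * mat_app d A x i)"
  by (simp add: mat_app_def sum_distrib_left algebra_simps)

text \<open>The stretch is continuous and has a maximum on the compact sphere; homogeneity carries
  the bound to all vectors. The maximum is positive because a nonzero entry of \<open>A\<close>
  gives a basis vector that is not annihilated.\<close>

lemma exists_maximal_stretch:
  assumes A: "A \<in> carrier_mat d d" "A \<noteq> 0\<^sub>m d d"
  shows "\<exists>v. sqnorm d v = 1 \<and> 0 < sqnorm d (mat_app d A v) \<and>
    (\<forall>y. sqnorm d (mat_app d A y) \<le> sqnorm d (mat_app d A v) * sqnorm d y)"
proof -
  let ?S = "{y :: nat \<Rightarrow> complex. (\<forall>i\<ge>d. y i = 0) \<and> sqnorm d y = 1}"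
  let ?h = "\<lambda>y. sqnorm d (mat_app d A y)"
  obtain k i where ki: "k < d" "i < d" "A $$ (k, i) \<noteq> 0"
    using A by (metis carrier_matD eq_matI index_zero_mat)
  define e where "e = (\<lambda>j. if j = i then 1 else 0 :: complex)"
  have e: "mat_app d A e l = A $$ (l, i)" for l
  proof -
    have "mat_app d A e l = (\<Sum>j<d. if j = i then A $$ (l, i) else 0)"
      unfolding mat_app_def e_def by (rule sum.cong) auto
    then show ?thesis using ki by simp
  qed
  have e1: "sqnorm d e = 1"
  proof -
    have "sqnorm d e = (\<Sum>j<d. if j = i then 1 else 0)"
      unfolding sqnorm_def e_def by (rule sum.cong) auto
    then show ?thesis using ki by simp
  qed
  have "e \<in> ?S" using ki e1 by (auto simp: e_def)
  have "continuous_on UNIV ?h"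
    unfolding sqnorm_def mat_app_def by (intro continuous_intros continuous_on_product_coordinates)
  then have "continuous_on ?S ?h" by (rule continuous_on_subset) simp
  then obtain v where v: "v \<in> ?S" "\<forall>y\<in>?S. ?h y \<le> ?h v"
    using continuous_attains_sup[OF compact_unit_sphere] \<open>e \<in> ?S\<close> by blast
  have "?h e \<noteq> 0" unfolding sqnorm_eq_0 e using ki by blast
  then have "0 < ?h e" using sqnorm_nonneg[of d "mat_app d A e"] by simp
  also have "?h e \<le> ?h v" using v(2) \<open>e \<in> ?S\<close> by blast
  finally have pos: "0 < ?h v" .
  have "?h y \<le> ?h v * sqnorm d y" for y
  proof (cases "sqnorm d y = 0")
    case True
    then have "?h y = 0" by (auto simp: sqnorm_eq_0 mat_app_def)
    then show ?thesis using True by simp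
  next
    case False
    then have n: "0 < sqnorm d y" using sqnorm_nonneg[of d y] by simp
    let ?c = "complex_of_real (1 / sqrt (sqnorm d y))"
    have c: "(cmod ?c)\<^sup>2 = 1 / sqnorm d y"
      using n by (simp only: norm_of_real power2_abs) (simp add: power_divide)
    \<comment> \<open>Besides being normalised, y is cut off at d, because membership in the sphere
      demands zeros from there on; neither \<open>sqnorm d\<close> nor \<open>mat_app d\<close> sees
      the cut.\<close>
    let ?z = "\<lambda>j. if j < d then ?c * y j else 0"
    have "sqnorm d ?z = sqnorm d (\<lambda>j. ?c * y j)" by (rule sqnorm_cong) simp
    then have "?z \<in> ?S" using n unfolding sqnorm_scale c by simp
    then have "?h ?z \<le> ?h v" using v(2) by blast
    moreover have "mat_app d A ?z = mat_app d A (\<lambda>j. ?c * y j)"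
      unfolding mat_app_def by (intro ext sum.cong) auto
    ultimately have "1 / sqnorm d y * ?h y \<le> ?h v"
      unfolding mat_app_scale sqnorm_scale c by (simp only: sqnorm_scale c)
    then show ?thesis using n by (simp add: field_simps)
  qed
  then show ?thesis using v(1) pos by blast
qed

text \<open>The factor \<alpha> divides \<open>A\<close> by its operator norm and turns the phase so
  that the inner product of u and v is nonnegative. That the adjoint takes u back to v is the
  equality case of Cauchy-Schwarz.\<close>

lemma exists_top_singular_pair:
  assumes A: "A \<in> carrier_mat d d" "A \<noteq> 0\<^sub>m d d"
  obtains \<alpha> u v \<rho> where
    "\<And>y. sqnorm d (mat_app d (\<alpha> \<cdot>\<^sub>m A) y) \<le> sqnorm d y"
    "sqnorm d u = 1" "sqnorm d v = 1"
    "\<And>k. k < d \<Longrightarrow> mat_app d (\<alpha> \<cdot>\<^sub>m A) v k = u k"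
    "\<And>k. k < d \<Longrightarrow> adj_app d (\<alpha> \<cdot>\<^sub>m A) u k = v k"
    "0 \<le> \<rho>" "cinner d u v = of_real \<rho>"
proof -
  obtain v where v: "sqnorm d v = 1" "0 < sqnorm d (mat_app d A v)"
    "\<And>y. sqnorm d (mat_app d A y) \<le> sqnorm d (mat_app d A v) * sqnorm d y"
    using exists_maximal_stretch[OF A] by blast
  define m where "m = sqrt (sqnorm d (mat_app d A v))"
  have m: "m > 0" "m\<^sup>2 = sqnorm d (mat_app d A v)" using v(2) by (auto simp: m_def)
  define z where "z = cinner d (mat_app d A v) v"
  \<comment> \<open>\<open>sgn 0\<close> is 0 and not a phase, so 1 is taken when z = 0.\<close>
  define \<omega> where "\<omega> = (if z = 0 then 1 else sgn z)"
  have \<omega>: "cmod \<omega> = 1" "cnj \<omega> * z = of_real (cmod z)"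
  proof -
    show "cmod \<omega> = 1" by (simp add: \<omega>_def norm_sgn)
    show "cnj \<omega> * z = of_real (cmod z)"
    proof (cases "z = 0")
      case False
      have "cnj \<omega> * z = (z * cnj z) / of_real (cmod z)"
        using False by (simp add: \<omega>_def sgn_div_norm scaleR_conv_of_real divide_inverse)
      then show ?thesis
        using False by (simp add: complex_norm_square[symmetric] power2_eq_square)
    qed simp
  qed
  define \<alpha> where "\<alpha> = \<omega> / of_real m"
  define Y where "Y = \<alpha> \<cdot>\<^sub>m A"
  define u where "u = mat_app d Y v"
  have \<alpha>: "(cmod \<alpha>)\<^sup>2 = 1 / m\<^sup>2" using \<omega> m by (simp add: \<alpha>_def norm_divide power_divide)
  have Y: "mat_app d Y y k = \<alpha> * mat_app d A y k" if "k < d" for y k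
    using A that by (simp add: Y_def mat_app_def sum_distrib_left mult.assoc)
  have sY: "sqnorm d (mat_app d Y y) = sqnorm d (mat_app d A y) / m\<^sup>2" for y
  proof -
    have "sqnorm d (mat_app d Y y) = sqnorm d (\<lambda>k. \<alpha> * mat_app d A y k)"
      by (rule sqnorm_cong) (rule Y)
    then show ?thesis unfolding sqnorm_scale \<alpha> by simp
  qed
  have contr: "sqnorm d (mat_app d Y y) \<le> sqnorm d y" for y
    using v(3)[of y] v(2) unfolding sY m(2) by (simp add: field_simps)
  have u1: "sqnorm d u = 1" unfolding u_def sY m(2) using v(2) by simp
  let ?w = "adj_app d Y u"
  let ?s = "sqnorm d ?w"
  \<comment> \<open>For w the image of u under the adjoint of Y: |w|^2 = <u, Y w> \<le> |u| |Y w|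
    \<le> |w|, hence |w| \<le> 1.\<close>
  have "of_real ?s = cinner d u (mat_app d Y ?w)"
    by (simp add: cinner_mat_app cinner_self)
  then have "?s\<^sup>2 = (cmod (cinner d u (mat_app d Y ?w)))\<^sup>2"
    by (metis norm_of_real power2_abs)
  also have "\<dots> \<le> sqnorm d u * sqnorm d (mat_app d Y ?w)" by (rule cinner_Cauchy_Schwarz)
  also have "\<dots> \<le> ?s" using u1 contr by simp
  finally have sq: "?s\<^sup>2 \<le> ?s" .
  have s1: "?s \<le> 1"
  proof (rule ccontr)
    assume "\<not> ?s \<le> 1"
    then have "?s * 1 < ?s * ?s" by (intro mult_strict_left_mono) auto
    then show False using sq by (simp add: power2_eq_square)
  qed
  have "cinner d ?w v = 1"
    unfolding cinner_mat_app[symmetric] u_def[symmetric] cinner_self u1 by simp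
  \<comment> \<open>As <w, v> = <u, Y v> = 1, the squared distance between w and v is |w|^2 - 1,
    which is at most 0; so the two agree.\<close>
  then have "sqnorm d (lincomb 1 ?w (- 1) v) = ?s + 1 - 2"
    by (simp add: sqnorm_lincomb v(1))
  then have "sqnorm d (lincomb 1 ?w (- 1) v) = 0"
    using s1 sqnorm_nonneg[of d "lincomb 1 ?w (- 1) v"] by linarith
  then have adj: "?w k = v k" if "k < d" for k
    using that by (simp add: sqnorm_eq_0 lincomb_def)
  have "cinner d u v = cinner d (\<lambda>k. \<alpha> * mat_app d A v k) v"
    unfolding u_def by (rule cinner_cong) (auto simp: Y)
  also have "\<dots> = cnj \<alpha> * z"
    by (simp add: z_def cinner_def sum_distrib_left mult.assoc)
  also have "\<dots> = of_real (cmod z / m)"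
    using \<omega>(2) by (simp add: \<alpha>_def)
  finally have "cinner d u v = of_real (cmod z / m)" .
  then show thesis
    using that[of \<alpha> u v "cmod z / m"] contr u1 v(1) adj m(1) by (simp add: Y_def u_def)
qed

section \<open>Block matrices and the Choi form\<close>

text \<open>This is the sesquilinear form x^* A w; it is a quadratic form only for x = w.\<close>

definition qform :: "nat \<Rightarrow> (nat \<Rightarrow> complex) \<Rightarrow> complex mat \<Rightarrow> (nat \<Rightarrow> complex) \<Rightarrow> complex" where
  "qform d x A w = cinner d x (mat_app d A w)"

definition ketbra :: "nat \<Rightarrow> (nat \<Rightarrow> complex) \<Rightarrow> (nat \<Rightarrow> complex) \<Rightarrow> complex mat" where
  "ketbra d y z = mat d d (\<lambda>(a, b). y a * cnj (z b))"

definition block_mat :: "nat \<Rightarrow> nat \<Rightarrow> (nat \<Rightarrow> nat \<Rightarrow> complex mat) \<Rightarrow> complex mat" where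
  "block_mat k d B = mat (k * d) (k * d)
     (\<lambda>(p, q). B (p div d) (q div d) $$ (p mod d, q mod d))"

lemma ketbra_carrier [simp]: "ketbra d y z \<in> carrier_mat d d"
  by (simp add: ketbra_def)

lemma qform_eq_sum: "qform d x A w = (\<Sum>i<d. \<Sum>j<d. cnj (x i) * A $$ (i, j) * w j)"
  by (simp add: qform_def cinner_def mat_app_def sum_distrib_left mult.assoc)

lemma qform_lincomb_left:
  "qform d (lincomb a x b y) A w = cnj a * qform d x A w + cnj b * qform d y A w"
  by (simp add: qform_def cinner_lincomb_left)

lemma qform_lincomb_right:
  "qform d x A (lincomb a w b z) = a * qform d x A w + b * qform d x A z"
  by (simp add: qform_eq_sum lincomb_def algebra_simps sum.distrib sum_distrib_left)

lemma sum_blocks: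
  fixes g :: "nat \<Rightarrow> 'a::comm_monoid_add"
  shows "(\<Sum>p<k * d. g p) = (\<Sum>a<k. \<Sum>i<d. g (a * d + i))"
proof -
  have "(\<Sum>p<k * d. g p) = (\<Sum>a<k. sum g {a * d..<a * d + d})" by (simp add: sum.nat_group)
  also have "\<dots> = (\<Sum>a<k. \<Sum>i<d. g (a * d + i))"
  proof (rule sum.cong[OF refl])
    fix a
    show "sum g {a * d..<a * d + d} = (\<Sum>i<d. g (a * d + i))"
      using sum.shift_bounds_nat_ivl[of g 0 "a * d" d] by (simp add: atLeast0LessThan add.commute)
  qed
  finally show ?thesis .
qed

lemma quadratic_form_block_mat:
  fixes x :: "nat \<Rightarrow> nat \<Rightarrow> complex" and k d :: nat
  defines "v \<equiv> vec (k * d) (\<lambda>p. x (p div d) (p mod d))"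
  shows "(block_mat k d B *\<^sub>v v) \<bullet>c v = (\<Sum>a<k. \<Sum>b<k. qform d (x a) (B a b) (x b))"
proof -
  let ?M = "block_mat k d B"
  have "(?M *\<^sub>v v) \<bullet>c v = (\<Sum>p<k * d. \<Sum>q<k * d. cnj (v $ p) * ?M $$ (p, q) * v $ q)"
    by (simp add: scalar_prod_def atLeast0LessThan v_def block_mat_def sum_distrib_left sum_distrib_right algebra_simps)
  also have "\<dots> = (\<Sum>a<k. \<Sum>i<d. \<Sum>b<k. \<Sum>j<d. cnj (x a i) * B a b $$ (i, j) * x b j)"
    unfolding sum_blocks
    by (intro sum.cong refl) (simp add: v_def block_mat_def block_index_less)
  also have "\<dots> = (\<Sum>a<k. \<Sum>b<k. qform d (x a) (B a b) (x b))"
    unfolding qform_eq_sum by (rule sum.cong[OF refl], rule sum.swap)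
  finally show ?thesis .
qed

section \<open>Positivity of block matrices\<close>

lemma mat_adjoint_index:
  fixes A :: "complex mat"
  assumes "A \<in> carrier_mat n n" "i < n" "j < n"
  shows "mat_adjoint A $$ (i, j) = cnj (A $$ (j, i))"
  using assms by (simp add: mat_adjoint_def mat_of_rows_def)

lemma mat_adjoint_eq_self_iff:
  fixes A :: "complex mat"
  assumes "A \<in> carrier_mat n n"
  shows "mat_adjoint A = A \<longleftrightarrow> (\<forall>i<n. \<forall>j<n. A $$ (i, j) = cnj (A $$ (j, i)))"
proof
  assume "mat_adjoint A = A"
  then show "\<forall>i<n. \<forall>j<n. A $$ (i, j) = cnj (A $$ (j, i))" using mat_adjoint_index[OF assms] by metis
next
  assume h: "\<forall>i<n. \<forall>j<n. A $$ (i, j) = cnj (A $$ (j, i))"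
  have "dim_row (mat_adjoint A) = n" "dim_col (mat_adjoint A) = n"
    using assms by (auto simp: mat_adjoint_def)
  moreover have "mat_adjoint A $$ (i, j) = A $$ (i, j)" if "i < n" "j < n" for i j
    using h[rule_format, OF that] mat_adjoint_index[OF assms that] by simp
  ultimately show "mat_adjoint A = A" using assms by (intro eq_matI) auto
qed

text \<open>Moves positivity from \<open>vec\<close> and flat indices to blocks and tuples of
  coordinate functions: each flat index is \<open>a * d + i\<close> in a unique way, and every
  vector of length \<open>k * d\<close> is a concatenation of k pieces.\<close>

lemma pos_semidef_block_mat:
  "pos_semidef (k * d) (block_mat k d B) \<longleftrightarrow>
     (\<forall>a<k. \<forall>b<k. \<forall>i<d. \<forall>j<d. B a b $$ (i, j) = cnj (B b a $$ (j, i))) \<and>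
     (\<forall>x. 0 \<le> Re (\<Sum>a<k. \<Sum>b<k. qform d (x a) (B a b) (x b)))"
  (is "_ \<longleftrightarrow> ?H \<and> ?P")
proof -
  let ?M = "block_mat k d B"
  have M: "?M \<in> carrier_mat (k * d) (k * d)" by (simp add: block_mat_def)
  have idx: "p div d < k \<and> p mod d < d" if "p < k * d" for p
    using that by (cases "d = 0") (auto simp: less_mult_imp_div_less)
  have "(\<forall>p<k * d. \<forall>q<k * d. ?M $$ (p, q) = cnj (?M $$ (q, p))) \<longleftrightarrow> ?H"
  proof
    assume h: "\<forall>p<k * d. \<forall>q<k * d. ?M $$ (p, q) = cnj (?M $$ (q, p))"
    show ?H
    proof (intro allI impI)
      fix a b i j assume l: "a < k" "b < k" "i < d" "j < d"
      then have "?M $$ (a * d + i, b * d + j) = cnj (?M $$ (b * d + j, a * d + i))"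
        using h block_index_less by blast
      then show "B a b $$ (i, j) = cnj (B b a $$ (j, i))"
        using l by (simp add: block_mat_def block_index_less)
    qed
  next
    assume h: ?H
    show "\<forall>p<k * d. \<forall>q<k * d. ?M $$ (p, q) = cnj (?M $$ (q, p))"
    proof (intro allI impI)
      fix p q assume l: "p < k * d" "q < k * d"
      have "B (p div d) (q div d) $$ (p mod d, q mod d)
          = cnj (B (q div d) (p div d) $$ (q mod d, p mod d))"
        using h idx[OF l(1)] idx[OF l(2)] by blast
      then show "?M $$ (p, q) = cnj (?M $$ (q, p))" using l by (simp add: block_mat_def)
    qed
  qed
  moreover have "(\<forall>v \<in> carrier_vec (k * d). 0 \<le> Re ((?M *\<^sub>v v) \<bullet>c v)) \<longleftrightarrow> ?P"
  proof
    assume h: "\<forall>v \<in> carrier_vec (k * d). 0 \<le> Re ((?M *\<^sub>v v) \<bullet>c v)"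
    show ?P
    proof
      fix x :: "nat \<Rightarrow> nat \<Rightarrow> complex"
      show "0 \<le> Re (\<Sum>a<k. \<Sum>b<k. qform d (x a) (B a b) (x b))"
        using h quadratic_form_block_mat[of k d B x, symmetric] by simp
    qed
  next
    assume h: ?P
    show "\<forall>v \<in> carrier_vec (k * d). 0 \<le> Re ((?M *\<^sub>v v) \<bullet>c v)"
    proof
      fix v :: "complex vec" assume v: "v \<in> carrier_vec (k * d)"
      let ?x = "\<lambda>a i. v $ (a * d + i)"
      have "vec (k * d) (\<lambda>p. ?x (p div d) (p mod d)) = v"
        using v by (intro eq_vecI) auto
      from quadratic_form_block_mat[of k d B ?x, unfolded this]
      show "0 \<le> Re ((?M *\<^sub>v v) \<bullet>c v)" using h by simp
    qed
  qed
  ultimately show ?thesis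
    unfolding pos_semidef_def mat_adjoint_eq_self_iff[OF M] using M by blast
qed

lemma id_tensor_block_mat:
  assumes "\<And>a b. a < k \<Longrightarrow> b < k \<Longrightarrow> B a b \<in> carrier_mat d d"
  shows "id_tensor k d \<Phi> (block_mat k d B) = block_mat k d (\<lambda>a b. \<Phi> (B a b))"
proof -
  have idx: "p div d < k \<and> p mod d < d" if "p < k * d" for p
    using that by (cases "d = 0") (auto simp: less_mult_imp_div_less)
  have "mat_block d (block_mat k d B) a b = B a b" if "a < k" "b < k" for a b
    using that assms[OF that] by (intro eq_matI) (auto simp: mat_block_def block_mat_def block_index_less)
  then show ?thesis
    using idx by (intro eq_matI) (auto simp: id_tensor_def block_mat_def)
qed

section \<open>Expansion in matrix units and the Choi form\<close>

locale two_positive_channel =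
  fixes d :: nat and \<Phi> :: "complex mat \<Rightarrow> complex mat"
  assumes linear: "linear_superop d \<Phi>"
    and two_positive: "two_positive d \<Phi>"
    and trace_preserving: "trace_preserving d \<Phi>"
begin

lemma superop_carrier: "A \<in> carrier_mat d d \<Longrightarrow> \<Phi> A \<in> carrier_mat d d"
  using linear by (auto simp: linear_superop_def)

lemma superop_add:
  "A \<in> carrier_mat d d \<Longrightarrow> B \<in> carrier_mat d d \<Longrightarrow> \<Phi> (A + B) = \<Phi> A + \<Phi> B"
  using linear by (auto simp: linear_superop_def)

lemma superop_smult: "A \<in> carrier_mat d d \<Longrightarrow> \<Phi> (c \<cdot>\<^sub>m A) = c \<cdot>\<^sub>m \<Phi> A"
  using linear by (auto simp: linear_superop_def)

lemma superop_zero: "\<Phi> (0\<^sub>m d d) = 0\<^sub>m d d"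
proof -
  have "\<Phi> (0 \<cdot>\<^sub>m 0\<^sub>m d d) = 0 \<cdot>\<^sub>m \<Phi> (0\<^sub>m d d)" by (rule superop_smult) simp
  moreover have "0 \<cdot>\<^sub>m \<Phi> (0\<^sub>m d d) = 0\<^sub>m d d"
    using superop_carrier[of "0\<^sub>m d d"] by (intro eq_matI) auto
  moreover have "0 \<cdot>\<^sub>m 0\<^sub>m d d = (0\<^sub>m d d :: complex mat)" by (intro eq_matI) auto
  ultimately show ?thesis by simp
qed

text \<open>The matrix is assembled one entry at a time: \<open>R S\<close> keeps the entries at
  positions in S, and enlarging S by one position adds a multiple of a matrix unit, so additivity
  and homogeneity of \<Phi> suffice.\<close>

lemma superop_index:
  assumes A: "A \<in> carrier_mat d d" and kl: "k < d" "l < d"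
  shows "\<Phi> A $$ (k, l) = (\<Sum>a<d. \<Sum>b<d. A $$ (a, b) * \<Phi> (matrix_unit d a b) $$ (k, l))"
proof -
  define R where "R S = mat d d (\<lambda>p. if p \<in> S then A $$ p else 0)" for S
  have R: "R S \<in> carrier_mat d d" for S by (simp add: R_def)
  have "\<Phi> (R S) $$ (k, l) = (\<Sum>(a, b)\<in>S. A $$ (a, b) * \<Phi> (matrix_unit d a b) $$ (k, l))"
    if "finite S" "S \<subseteq> {..<d} \<times> {..<d}" for S
    using that
  proof (induction S rule: finite_induct)
    case empty
    have "R {} = 0\<^sub>m d d" by (intro eq_matI) (auto simp: R_def)
    then show ?case using kl by (simp add: superop_zero)
  next
    case (insert p S)
    obtain a b where p: "p = (a, b)" by fastforce
    have ab: "a < d" "b < d" using insert.prems p by auto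
    have E: "matrix_unit d a b \<in> carrier_mat d d" by (simp add: matrix_unit_def)
    have "R (insert p S) = R S + A $$ (a, b) \<cdot>\<^sub>m matrix_unit d a b"
      using insert.hyps p by (intro eq_matI) (auto simp: R_def matrix_unit_def)
    then have "\<Phi> (R (insert p S)) = \<Phi> (R S) + A $$ (a, b) \<cdot>\<^sub>m \<Phi> (matrix_unit d a b)"
      using R E by (simp add: superop_add superop_smult)
    then show ?case
      using insert kl superop_carrier[OF E] superop_carrier[OF R[of S]] by (simp add: p add.commute)
  qed
  from this[of "{..<d} \<times> {..<d}"]
  have "\<Phi> (R ({..<d} \<times> {..<d})) $$ (k, l) =
      (\<Sum>a<d. \<Sum>b<d. A $$ (a, b) * \<Phi> (matrix_unit d a b) $$ (k, l))"
    by (simp add: sum.cartesian_product)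
  moreover have "R ({..<d} \<times> {..<d}) = A" using A by (intro eq_matI) (auto simp: R_def)
  ultimately show ?thesis by simp
qed

lemma qform_superop:
  assumes A: "A \<in> carrier_mat d d"
  shows "qform d x (\<Phi> A) w = (\<Sum>a<d. \<Sum>b<d. A $$ (a, b) * qform d x (\<Phi> (matrix_unit d a b)) w)"
proof -
  let ?t = "\<lambda>a b k l. A $$ (a, b) * (cnj (x k) * \<Phi> (matrix_unit d a b) $$ (k, l) * w l)"
  have "qform d x (\<Phi> A) w = (\<Sum>k<d. \<Sum>l<d. \<Sum>a<d. \<Sum>b<d. ?t a b k l)"
    unfolding qform_eq_sum
    by (intro sum.cong refl) (simp add: superop_index[OF A] sum_distrib_left sum_distrib_right algebra_simps)
  also have "\<dots> = (\<Sum>k<d. \<Sum>a<d. \<Sum>l<d. \<Sum>b<d. ?t a b k l)"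
    by (rule sum.cong[OF refl], rule sum.swap)
  also have "\<dots> = (\<Sum>a<d. \<Sum>k<d. \<Sum>l<d. \<Sum>b<d. ?t a b k l)" by (rule sum.swap)
  also have "\<dots> = (\<Sum>a<d. \<Sum>k<d. \<Sum>b<d. \<Sum>l<d. ?t a b k l)"
    by (rule sum.cong[OF refl], rule sum.cong[OF refl], rule sum.swap)
  also have "\<dots> = (\<Sum>a<d. \<Sum>b<d. \<Sum>k<d. \<Sum>l<d. ?t a b k l)"
    by (rule sum.cong[OF refl], rule sum.swap)
  also have "\<dots> = (\<Sum>a<d. \<Sum>b<d. A $$ (a, b) * qform d x (\<Phi> (matrix_unit d a b)) w)"
    by (simp add: qform_eq_sum sum_distrib_left)
  finally show ?thesis .
qed

text \<open>The quadratic form of the Choi matrix of $\Phi$ on the matrices $xy^*$ and $wz^*$: it is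
  antilinear in $x$, $z$ and linear in $y$, $w$.\<close>

definition choi :: "(nat \<Rightarrow> complex) \<Rightarrow> (nat \<Rightarrow> complex) \<Rightarrow> (nat \<Rightarrow> complex) \<Rightarrow> (nat \<Rightarrow> complex) \<Rightarrow> complex" where
  "choi x y w z = qform d x (\<Phi> (ketbra d y z)) w"

lemma choi_eq_sum:
  "choi x y w z = (\<Sum>a<d. \<Sum>b<d. y a * cnj (z b) * qform d x (\<Phi> (matrix_unit d a b)) w)"
  unfolding choi_def qform_superop[OF ketbra_carrier]
  by (intro sum.cong refl) (simp add: ketbra_def)

lemma choi_lincomb:
  "choi (lincomb a x b x') y w z = cnj a * choi x y w z + cnj b * choi x' y w z"
  "choi x (lincomb a y b y') w z = a * choi x y w z + b * choi x y' w z"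
  "choi x y (lincomb a w b w') z = a * choi x y w z + b * choi x y w' z"
  "choi x y w (lincomb a z b z') = cnj a * choi x y w z + cnj b * choi x y w z'"
proof -
  show "choi (lincomb a x b x') y w z = cnj a * choi x y w z + cnj b * choi x' y w z"
    by (simp add: choi_def qform_lincomb_left)
  show "choi x y (lincomb a w b w') z = a * choi x y w z + b * choi x y w' z"
    by (simp add: choi_def qform_lincomb_right)
  show "choi x (lincomb a y b y') w z = a * choi x y w z + b * choi x y' w z"
    by (simp add: choi_eq_sum lincomb_def algebra_simps sum.distrib sum_distrib_left)
  show "choi x y w (lincomb a z b z') = cnj a * choi x y w z + cnj b * choi x y w z'"
    by (simp add: choi_eq_sum lincomb_def algebra_simps sum.distrib sum_distrib_left)
qed

text \<open>The form in which 2-positivity is applied. Hermiticity of the image yields the symmetry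
  of the Choi form, and nonnegativity of the image yields the inequalities.\<close>

lemma two_positive_blocks:
  fixes B :: "nat \<Rightarrow> nat \<Rightarrow> complex mat"
  assumes "\<And>a b. a < 2 \<Longrightarrow> b < 2 \<Longrightarrow> B a b \<in> carrier_mat d d"
    and "\<And>a b i j. a < 2 \<Longrightarrow> b < 2 \<Longrightarrow> i < d \<Longrightarrow> j < d \<Longrightarrow> B a b $$ (i, j) = cnj (B b a $$ (j, i))"
    and "\<And>x. 0 \<le> Re (\<Sum>a<2. \<Sum>b<2. qform d (x a) (B a b) (x b))"
  shows "\<And>a b i j. a < 2 \<Longrightarrow> b < 2 \<Longrightarrow> i < d \<Longrightarrow> j < d \<Longrightarrow>
      \<Phi> (B a b) $$ (i, j) = cnj (\<Phi> (B b a) $$ (j, i))"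
    and "0 \<le> Re (\<Sum>a<2. \<Sum>b<2. qform d (x a) (\<Phi> (B a b)) (x b))"
proof -
  have "pos_semidef (2 * d) (block_mat 2 d B)"
    using assms(2,3) unfolding pos_semidef_block_mat by blast
  then have "pos_semidef (2 * d) (id_tensor 2 d \<Phi> (block_mat 2 d B))"
    using two_positive unfolding two_positive_def positive_superop_def by blast
  then have *: "pos_semidef (2 * d) (block_mat 2 d (\<lambda>a b. \<Phi> (B a b)))"
    using id_tensor_block_mat[of 2 B d \<Phi>] assms(1) by simp
  then show "\<And>a b i j. a < 2 \<Longrightarrow> b < 2 \<Longrightarrow> i < d \<Longrightarrow> j < d \<Longrightarrow>
      \<Phi> (B a b) $$ (i, j) = cnj (\<Phi> (B b a) $$ (j, i))"
    unfolding pos_semidef_block_mat by blast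
  show "0 \<le> Re (\<Sum>a<2. \<Sum>b<2. qform d (x a) (\<Phi> (B a b)) (x b))"
    using * unfolding pos_semidef_block_mat by blast
qed

end

section \<open>The coefficient inequality\<close>

text \<open>For unit vectors with real inner product, u + v and u - v are orthogonal; normalised,
  they become \<open>f 0\<close> and \<open>f 1\<close>. As \<rho> is nonnegative, u - v is the
  shorter one, hence the bound on s.\<close>

lemma symmetric_pair_basis:
  assumes d: "2 \<le> d" and u: "sqnorm d u = 1" and v: "sqnorm d v = 1"
    and \<rho>: "cinner d u v = of_real \<rho>" "0 \<le> \<rho>"
  obtains f and c s :: real where "orthonormal d d f" "0 \<le> c" "0 \<le> s" "c\<^sup>2 + s\<^sup>2 = 1" "s\<^sup>2 \<le> 1 / 2"
    "\<And>i. i < d \<Longrightarrow> u i = lincomb c (f 0) s (f 1) i"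
    "\<And>i. i < d \<Longrightarrow> v i = lincomb c (f 0) (- s) (f 1) i"
proof -
  have \<rho>': "cinner d v u = of_real \<rho>" using cnj_cinner[of d u v] \<rho> by simp
  have uu: "cinner d u u = 1" "cinner d v v = 1" by (simp_all add: cinner_self u v)
  have diff: "sqnorm d (lincomb 1 u (- 1) v) = 2 - 2 * \<rho>"
    by (simp add: sqnorm_lincomb u v \<rho>)
  then have \<rho>1: "\<rho> \<le> 1" using sqnorm_nonneg[of d "lincomb 1 u (- 1) v"] by simp
  \<comment> \<open>Chosen so that |u + v|^2 = 2 + 2 \<rho> = 4 c^2 and |u - v|^2 = 2 - 2 \<rho> = 4
    s^2.\<close>
  define c s where "c = sqrt ((1 + \<rho>) / 2)" and "s = sqrt ((1 - \<rho>) / 2)"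
  have c2: "c\<^sup>2 = (1 + \<rho>) / 2" and s2: "s\<^sup>2 = (1 - \<rho>) / 2" using \<rho> \<rho>1 by (auto simp: c_def s_def)
  have c: "c > 0" using \<rho> by (simp add: c_def)
  have s: "s \<ge> 0" using \<rho>1 by (simp add: s_def)
  define k where "k = 1 / (2 * complex_of_real c)"
  have ck: "cnj k = k" by (simp add: k_def)
  define g where "g = lincomb k u k v"
  have cc: "complex_of_real c * of_real c = (1 + of_real \<rho>) / 2"
    using arg_cong[OF c2, of complex_of_real] by (simp add: power2_eq_square)
  have ss: "complex_of_real s * of_real s = (1 - of_real \<rho>) / 2"
    using arg_cong[OF s2, of complex_of_real] by (simp add: power2_eq_square)
  have cc4: "4 * (complex_of_real c * of_real c) = 2 + 2 * of_real \<rho>"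
    and ss4: "4 * (complex_of_real s * of_real s) = 2 - 2 * of_real \<rho>"
    unfolding cc ss by (simp_all add: field_simps)
  have g1: "cinner d g g = 1"
  proof -
    have "cinner d g g = k * k * (2 + 2 * of_real \<rho>)"
      by (simp add: g_def ck cinner_lincomb_left cinner_lincomb_right uu \<rho> \<rho>' algebra_simps)
    also have "\<dots> = (2 + 2 * of_real \<rho>) / (4 * (complex_of_real c * of_real c))"
      by (simp add: k_def)
    also have "\<dots> = (2 + 2 * of_real \<rho>) / (2 + 2 * of_real \<rho>)" using cc4 by simp
    also have "\<dots> = 1"
    proof -
      have "2 + 2 * \<rho> \<noteq> 0" using \<rho>(2) by simp
      then have "complex_of_real (2 + 2 * \<rho>) \<noteq> 0" by (simp only: of_real_eq_0_iff not_False_eq_True)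
      then show ?thesis by simp
    qed
    finally show ?thesis .
  qed
  have ge: "of_real c * g i = (u i + v i) / 2" for i
    using c by (simp add: g_def lincomb_def k_def field_simps)
  have half: "s\<^sup>2 \<le> 1 / 2" using \<rho> s2 by simp
  have sum1: "c\<^sup>2 + s\<^sup>2 = 1" using c2 s2 by (simp add: field_simps)
  show thesis
  proof (cases "s = 0")
    \<comment> \<open>For s = 0 the two vectors coincide and u - v cannot be normalised;
      \<open>f 1\<close> is then any unit vector orthogonal to \<open>f 0\<close>.\<close>
    case True
    then have "sqnorm d (lincomb 1 u (- 1) v) = 0" using s2 diff by simp
    then have uv: "u i = v i" if "i < d" for i using that by (simp add: sqnorm_eq_0 lincomb_def)
    have "orthonormal d 1 (\<lambda>_. g)" using g1 by (simp add: orthonormal_def)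
    then obtain f where f: "orthonormal d d f" "f 0 = g"
      using orthonormal_extend[of d 1 "\<lambda>_. g"] d by auto
    have "of_real c * f 0 i = v i" if "i < d" for i
      using ge[of i] uv[OF that] f(2) by simp
    then show thesis
      by (intro that[of f c s]) (use f(1) c s half sum1 uv True in \<open>auto simp: lincomb_def\<close>)
  next
    case False
    define l where "l = 1 / (2 * complex_of_real s)"
    have cl: "cnj l = l" by (simp add: l_def)
    define h where "h = lincomb l u (- l) v"
    have h1: "cinner d h h = 1"
    proof -
      have "cinner d h h = l * l * (2 - 2 * of_real \<rho>)"
        by (simp add: h_def cl cinner_lincomb_left cinner_lincomb_right uu \<rho> \<rho>' algebra_simps)
      also have "\<dots> = (2 - 2 * of_real \<rho>) / (4 * (complex_of_real s * of_real s))"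
        by (simp add: l_def)
      also have "\<dots> = (2 - 2 * of_real \<rho>) / (2 - 2 * of_real \<rho>)" using ss4 by simp
      also have "\<dots> = 1"
      proof -
        have "2 - 2 * \<rho> \<noteq> 0" using False s2 by auto
        then have "complex_of_real (2 - 2 * \<rho>) \<noteq> 0" by (simp only: of_real_eq_0_iff not_False_eq_True)
        then show ?thesis by simp
      qed
      finally show ?thesis .
    qed
    have gh: "cinner d g h = 0"
      by (simp add: g_def h_def cinner_lincomb_left cinner_lincomb_right uu \<rho> \<rho>' algebra_simps)
    then have hg: "cinner d h g = 0" using cnj_cinner[of d g h] by simp
    have he: "of_real s * h i = (u i - v i) / 2" for i
      using False by (simp add: h_def lincomb_def l_def field_simps)
    have "orthonormal d 2 (\<lambda>i. if i = 0 then g else h)"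
      using g1 h1 gh hg by (auto simp: orthonormal_def less_2_cases_iff)
    then obtain f where f: "orthonormal d d f"
      "\<forall>i<2. f i = (if i = 0 then g else h)"
      using orthonormal_extend[of d 2 "\<lambda>i. if i = 0 then g else h"] d by auto
    then have "f 0 = g" "f 1 = h" by auto
    then have "u i = lincomb c (f 0) s (f 1) i" "v i = lincomb c (f 0) (- s) (f 1) i" for i
      by (simp_all add: lincomb_def ge he field_simps)
    then show thesis by (intro that[of f c s]) (use f(1) c s half sum1 in auto)
  qed
qed

lemma sum_split_first_two:
  fixes g :: "nat \<Rightarrow> real"
  assumes "2 \<le> d"
  shows "(\<Sum>i<d. g i) = g 0 + g 1 + (\<Sum>i=2..<d. g i)"
proof -
  have "{..<d} = {0, 1} \<union> {2..<d}" using assms by auto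
  then have "(\<Sum>i<d. g i) = sum g {0, 1} + sum g {2..<d}"
    by (simp only:) (rule sum.union_disjoint, auto)
  then show ?thesis by simp
qed

text \<open>The real-number core, with C = c^2 and S = s^2. \<open>col\<close> expresses trace
  preservation, \<open>P2\<close> the test on a difference of two projections and \<open>E\<close>
  the averaged rank two test; the bracket multiplied by d is the lower bound for the real part of
  the eigenvalue. Indices 0 and 1 carry the singular pair, the others enter only through
  sums.\<close>

lemma trace_inequality_coefficients:
  fixes p q :: "nat \<Rightarrow> nat \<Rightarrow> real" and C S :: real
  assumes d: "2 \<le> d"
    and p0: "\<And>i j. i < d \<Longrightarrow> j < d \<Longrightarrow> 0 \<le> p i j"
    and pq: "\<And>i. i < d \<Longrightarrow> p i i = q i i"
    and col: "\<And>j. j < d \<Longrightarrow> (\<Sum>i<d. p i j) = 1"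
    and P2: "\<And>i j. i < d \<Longrightarrow> j < d \<Longrightarrow> q i j + q j i \<le> q i i + q j j"
    and E: "\<And>j. 2 \<le> j \<Longrightarrow> j < d \<Longrightarrow>
      0 \<le> q 0 0 + q 1 1 + 4 * q j j + q 0 1 + q 1 0 - 2 * (q 0 j + q j 0 + q 1 j + q j 1)
        + 2 * (p 1 j + p j 1)"
    and CS: "0 \<le> C" "0 \<le> S" "C + S = 1" "S \<le> 1 / 2"
  shows "(\<Sum>i<d. \<Sum>j<d. q i j) \<le> (real d)\<^sup>2 - real d
    + real d * (2 * C\<^sup>2 * q 0 0 + 2 * S\<^sup>2 * q 1 1 + 2 * C * S * (q 0 1 + q 1 0)
        - C * (\<Sum>j<d. p 0 j) - S * (\<Sum>j<d. p 1 j))"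
proof -
  let ?J = "{2..<d}"
  define A0 A0' A1 A1' where "A0 = (\<Sum>j\<in>?J. p 0 j)" and "A0' = (\<Sum>j\<in>?J. p j 0)"
    and "A1 = (\<Sum>j\<in>?J. p 1 j)" and "A1' = (\<Sum>j\<in>?J. p j 1)"
  define PJ QJ D where "PJ = (\<Sum>i\<in>?J. \<Sum>j\<in>?J. p i j)" and "QJ = (\<Sum>i\<in>?J. \<Sum>j\<in>?J. q i j)"
    and "D = (\<Sum>j\<in>?J. q j j)"
  define Q where "Q = (\<Sum>j\<in>?J. q 0 j + q j 0 + q 1 j + q j 1)"
  define e where "e = q 0 0 + q 1 1"
  define m where "m = q 0 1 + q 1 0"
  note split = sum_split_first_two[OF d]
  have cJ: "real (card ?J) = real d - 2" using d by simp
  have l: "0 < d" "1 < d" using d by auto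
  have F1: "p 0 0 + p 1 0 + A0' = 1" and F2: "p 0 1 + p 1 1 + A1' = 1"
    using col[OF l(1)] col[OF l(2)] by (simp_all add: split A0'_def A1'_def)
  have "(\<Sum>i<d. \<Sum>j<d. p i j) = (\<Sum>j<d. \<Sum>i<d. p i j)" by (rule sum.swap)
  also have "\<dots> = real d" using col by simp
  finally have F3: "p 0 0 + p 0 1 + p 1 0 + p 1 1 + A0 + A0' + A1 + A1' + PJ = real d"
    by (simp add: split sum.distrib A0_def A0'_def A1_def A1'_def PJ_def)
  have sq: "(\<Sum>i<d. \<Sum>j<d. q i j) = e + m + Q + QJ"
    by (simp add: split sum.distrib Q_def QJ_def e_def m_def)
  \<comment> \<open>Symmetrising the double sum lets \<open>P2\<close> bound each term by diagonal
    ones.\<close>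
  have F4: "QJ \<le> (real d - 2) * D"
  proof -
    have "QJ + QJ = QJ + (\<Sum>i\<in>?J. \<Sum>j\<in>?J. q j i)"
      unfolding QJ_def by (subst (3) sum.swap) simp
    also have "\<dots> = (\<Sum>i\<in>?J. \<Sum>j\<in>?J. q i j + q j i)" by (simp add: QJ_def sum.distrib)
    also have "\<dots> \<le> (\<Sum>i\<in>?J. \<Sum>j\<in>?J. q i i + q j j)" by (intro sum_mono P2) auto
    also have "\<dots> = 2 * (real (card ?J) * D)"
      by (simp add: sum.distrib D_def sum_distrib_left)
    finally have "QJ + QJ \<le> 2 * ((real d - 2) * D)" unfolding cJ .
    then show ?thesis by simp
  qed
  have F5: "D \<le> PJ"
    unfolding D_def PJ_def
  proof (rule sum_mono)
    fix i assume i: "i \<in> ?J"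
    have "p i i \<le> (\<Sum>j\<in>?J. p i j)" using i by (intro member_le_sum) (auto intro: p0)
    then show "q i i \<le> (\<Sum>j\<in>?J. p i j)" using pq[of i] i by simp
  qed
  have D0: "0 \<le> D" unfolding D_def using p0 pq by (intro sum_nonneg) (metis atLeastLessThan_iff)
  have A: "0 \<le> A0" "0 \<le> A0'" "0 \<le> A1" "0 \<le> A1'"
    unfolding A0_def A0'_def A1_def A1'_def using l by (auto intro!: sum_nonneg p0)
  have em: "m \<le> e" using P2[OF l] by (simp add: m_def e_def)
  \<comment> \<open>With this weight the right-hand side has coefficient 1 - t/2 at \<open>e\<close>
    and t/2 at \<open>m\<close>, see \<open>rhs\<close>. It is at most 1 since 4 C S \<le> (C +
    S)^2.\<close>
  define t where "t = 4 * C * S"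
  have t0: "0 \<le> t" using CS by (simp add: t_def)
  have t1: "t \<le> 1"
  proof -
    have "0 \<le> (C - S)\<^sup>2" by simp
    also have "\<dots> = (C + S)\<^sup>2 - t" by (simp add: power2_eq_square algebra_simps t_def)
    finally show ?thesis using CS(3) by simp
  qed
  \<comment> \<open>Convex combination, with weight $t$, of the triple inequality and the sum of two pair
    inequalities.\<close>
  have F6: "t * ((real d - 2) * (e - m) / 2 - (A1 + A1')) \<le> (real d - 2) * e + 2 * D - Q"
  proof -
    have "t * ((e - m) / 2 - (p 1 j + p j 1)) \<le> e + 2 * q j j - (q 0 j + q j 0 + q 1 j + q j 1)"
      (is "t * ?x \<le> ?y") if "j \<in> ?J" for j
    proof -
      have j: "2 \<le> j" "j < d" using that by auto
      have "?x \<le> ?y" using E[OF j] by (simp add: e_def m_def field_simps)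
      moreover have "0 \<le> ?y" using P2[OF l(1) j(2)] P2[OF l(2) j(2)] by (simp add: e_def)
      ultimately have "t * ?x \<le> t * ?y" "t * ?y \<le> ?y"
        using t0 t1 by (auto intro: mult_left_mono mult_left_le_one_le)
      then show ?thesis by linarith
    qed
    then have "(\<Sum>j\<in>?J. t * ((e - m) / 2 - (p 1 j + p j 1)))
        \<le> (\<Sum>j\<in>?J. e + 2 * q j j - (q 0 j + q j 0 + q 1 j + q j 1))" by (rule sum_mono)
    also have "\<dots> = real (card ?J) * e + 2 * D - Q"
      by (simp add: sum.distrib sum_subtractf D_def Q_def sum_distrib_left)
    also have "(\<Sum>j\<in>?J. t * ((e - m) / 2 - (p 1 j + p j 1)))
        = t * (real (card ?J) * ((e - m) / 2) - (A1 + A1'))"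
      by (simp add: sum.distrib sum_subtractf A1_def A1'_def sum_distrib_left[symmetric])
    finally show ?thesis unfolding cJ by simp
  qed
  have S: "S = 1 - C" using CS(3) by simp
  have R0: "(\<Sum>j<d. p 0 j) = q 0 0 + p 0 1 + A0" and R1: "(\<Sum>j<d. p 1 j) = p 1 0 + q 1 1 + A1"
    using pq[OF l(1)] pq[OF l(2)] by (simp_all add: split A0_def A1_def)
  have t2: "t / 2 = 2 * C * (1 - C)" by (simp add: t_def S)
  have rhs: "(real d)\<^sup>2 - real d
      + real d * (2 * C\<^sup>2 * q 0 0 + 2 * S\<^sup>2 * q 1 1 + 2 * C * S * (q 0 1 + q 1 0)
        - C * (\<Sum>j<d. p 0 j) - S * (\<Sum>j<d. p 1 j))
     = real d * (PJ + S * (A0 + A0') + C * (A1 + A1') + (1 - t / 2) * e + t / 2 * m)"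
  proof -
    \<comment> \<open>Here d is the sum of all \<open>p i j\<close> by \<open>F3\<close>, and 1 = C
      + S is the sum of columns 0 and 1 weighted by C and S. Once rows 0 and 1 are subtracted with
      the same weights, \<open>p 0 1\<close> and \<open>p 1 0\<close> cancel.\<close>
    have "real d - 1 = p 0 0 + p 0 1 + p 1 0 + p 1 1 + A0 + A0' + A1 + A1' + PJ
        - C * (p 0 0 + p 1 0 + A0') - S * (p 0 1 + p 1 1 + A1')"
      unfolding F1 F2 F3 using CS(3) by (simp add: algebra_simps)
    then have "real d - 1 + (2 * C\<^sup>2 * q 0 0 + 2 * S\<^sup>2 * q 1 1 + 2 * C * S * (q 0 1 + q 1 0)
        - C * (\<Sum>j<d. p 0 j) - S * (\<Sum>j<d. p 1 j))
      = PJ + S * (A0 + A0') + C * (A1 + A1') + (1 - t / 2) * e + t / 2 * m"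
      unfolding R0 R1 t2 e_def m_def S pq[OF l(1)] pq[OF l(2)]
      by (simp add: power2_eq_square algebra_simps)
    then have "real d * (real d - 1 + (2 * C\<^sup>2 * q 0 0 + 2 * S\<^sup>2 * q 1 1 + 2 * C * S * (q 0 1 + q 1 0)
        - C * (\<Sum>j<d. p 0 j) - S * (\<Sum>j<d. p 1 j)))
      = real d * (PJ + S * (A0 + A0') + C * (A1 + A1') + (1 - t / 2) * e + t / 2 * m)"
      by (rule arg_cong)
    then show ?thesis by (simp add: power2_eq_square algebra_simps)
  qed
  \<comment> \<open>After \<open>F4\<close> and \<open>F6\<close> the gap between the two sides is
    at least the sum of (1 - t) (e - m), (d C - t) (A1 + A1'), d (PJ - D) and d S (A0 + A0'); each
    is nonnegative.\<close>
  have "0 \<le> (1 - t) * (e - m)" using t1 em by simp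
  moreover have "t * (A1 + A1') \<le> real d * (C * (A1 + A1'))"
  proof -
    \<comment> \<open>The bounds S \<le> 1/2 and d \<ge> 2 combine to t = 4 S C \<le> d C.\<close>
    have "4 * S \<le> real d" using CS(4) d by linarith
    then have "(4 * S) * (C * (A1 + A1')) \<le> real d * (C * (A1 + A1'))"
      using CS(1) A by (intro mult_right_mono) auto
    then show ?thesis by (simp add: t_def algebra_simps)
  qed
  moreover have "real d * D \<le> real d * PJ" using F5 by (simp add: mult_left_mono)
  moreover have "0 \<le> real d * (S * (A0 + A0'))" using A CS by simp
  moreover note F4 F6
  ultimately have "e + m + Q + QJ
      \<le> real d * (PJ + S * (A0 + A0') + C * (A1 + A1') + (1 - t / 2) * e + t / 2 * m)"
    by (simp add: algebra_simps add_divide_distrib diff_divide_distrib)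
  then show ?thesis unfolding sq rhs .
qed

section \<open>Two-positive trace-preserving maps\<close>

lemma qform_ketbra: "qform d x (ketbra d y z) w = cinner d x y * cinner d z w"
  unfolding qform_eq_sum ketbra_def cinner_def sum_product
  by (intro sum.cong refl) (simp add: mult_ac)

text \<open>The blocks together form a rank one matrix, so the quadratic form is the squared modulus
  of the single sum \<open>s\<close>.\<close>

lemma qform_ketbra_blocks_nonneg:
  "0 \<le> Re (\<Sum>a\<in>I. \<Sum>b\<in>I. qform d (x a) (ketbra d (y a) (y b)) (x b))"
proof -
  define s where "s = (\<Sum>a\<in>I. cinner d (x a) (y a))"
  have "(\<Sum>a\<in>I. \<Sum>b\<in>I. qform d (x a) (ketbra d (y a) (y b)) (x b)) = s * cnj s"
    by (simp only: s_def qform_ketbra sum_product cnj_sum cnj_cinner)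
  also have "\<dots> = of_real ((cmod s)\<^sup>2)" by (rule complex_norm_square[symmetric])
  finally show ?thesis by (simp only: Re_complex_of_real zero_le_power2)
qed

lemma qform_minus:
  assumes "A \<in> carrier_mat d d" "B \<in> carrier_mat d d"
  shows "qform d x (A - B) w = qform d x A w - qform d x B w"
  using assms by (simp add: qform_eq_sum algebra_simps sum_subtractf)

lemma qform_one: "qform d x (1\<^sub>m d) w = cinner d x w"
proof -
  have "qform d x (1\<^sub>m d) w = (\<Sum>i<d. \<Sum>j<d. if j = i then cnj (x i) * w i else 0)"
    unfolding qform_eq_sum by (intro sum.cong refl) auto
  then show ?thesis by (simp add: cinner_def)
qed

lemma qform_adjoint:
  assumes "\<And>i j. i < d \<Longrightarrow> j < d \<Longrightarrow> B $$ (i, j) = cnj (A $$ (j, i))"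
  shows "qform d x B w = cnj (qform d w A x)"
proof -
  have "qform d x B w = (\<Sum>i<d. \<Sum>j<d. cnj (cnj (w j) * A $$ (j, i) * x i))"
    unfolding qform_eq_sum by (intro sum.cong refl) (simp add: assms)
  also have "\<dots> = (\<Sum>j<d. \<Sum>i<d. cnj (cnj (w j) * A $$ (j, i) * x i))" by (rule sum.swap)
  finally show ?thesis by (simp add: qform_eq_sum)
qed

text \<open>Completeness turns the sum over i into a delta at a = b. An arbitrary \<open>K\<close>
  lets this serve the trace of a matrix, the image of the identity and the trace of \<Phi>
  alike.\<close>

lemma sum_orthonormal_basis:
  assumes f: "orthonormal d d f"
  shows "(\<Sum>i<d. \<Sum>a<d. \<Sum>b<d. f i a * cnj (f i b) * K a b) = (\<Sum>a<d. K a a)"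
proof -
  have "(\<Sum>i<d. \<Sum>a<d. \<Sum>b<d. f i a * cnj (f i b) * K a b)
      = (\<Sum>a<d. \<Sum>i<d. \<Sum>b<d. f i a * cnj (f i b) * K a b)" by (rule sum.swap)
  also have "\<dots> = (\<Sum>a<d. \<Sum>b<d. \<Sum>i<d. f i a * cnj (f i b) * K a b)"
    by (rule sum.cong[OF refl], rule sum.swap)
  also have "\<dots> = (\<Sum>a<d. \<Sum>b<d. if b = a then K a a else 0)"
    by (intro sum.cong refl) (auto simp: sum_distrib_right[symmetric] orthonormal_complete[OF f])
  finally show ?thesis by simp
qed

lemma mat_trace_orthonormal_basis:
  assumes f: "orthonormal d d f" and A: "A \<in> carrier_mat d d"
  shows "(\<Sum>i<d. qform d (f i) A (f i)) = mat_trace A"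
proof -
  have "qform d (f i) A (f i) = (\<Sum>a<d. \<Sum>b<d. f i a * cnj (f i b) * A $$ (b, a))" for i
    unfolding qform_eq_sum by (subst sum.swap) (simp add: algebra_simps)
  then show ?thesis
    using A by (simp add: sum_orthonormal_basis[OF f] mat_trace_def)
qed

section \<open>Symmetry, sums and inequalities of the Choi form\<close>

context two_positive_channel
begin

text \<open>Nonnegativity of the Choi form on x y^* + x' y'^*, a matrix of rank at most two: the
  test matrix is the rank one block matrix built from y and y', and its image is paired with (x,
  x').\<close>

lemma choi_two_positive:
  "0 \<le> Re (choi x y x y + choi x y x' y' + choi x' y' x y + choi x' y' x' y')"
proof -
  define X Y where "X a = (if a = 0 then x else x')" and "Y a = (if a = 0 then y else y')" for a :: nat
  have "0 \<le> Re (\<Sum>a<2. \<Sum>b<2. qform d (X a) (\<Phi> (ketbra d (Y a) (Y b))) (X b))"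
  proof (rule two_positive_blocks(2))
    fix z :: "nat \<Rightarrow> nat \<Rightarrow> complex"
    show "0 \<le> Re (\<Sum>a<2. \<Sum>b<2. qform d (z a) (ketbra d (Y a) (Y b)) (z b))"
      by (rule qform_ketbra_blocks_nonneg)
  qed (auto simp: ketbra_def)
  then show ?thesis by (simp add: numeral_2_eq_2 X_def Y_def choi_def)
qed

lemma choi_nonneg: "0 \<le> Re (choi x y x y)"
  using choi_two_positive[of x y x y] by simp

text \<open>\<Phi> respects adjoints, as the two off-diagonal blocks of a positive image
  show.\<close>

lemma cnj_choi: "cnj (choi x y w z) = choi w z x y"
proof -
  define Y where "Y a = (if a = 0 then y else z)" for a :: nat
  have "\<Phi> (ketbra d (Y 1) (Y 0)) $$ (i, j) = cnj (\<Phi> (ketbra d (Y 0) (Y 1)) $$ (j, i))"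
    if "i < d" "j < d" for i j
  proof (rule two_positive_blocks(1)[where B = "\<lambda>a b. ketbra d (Y a) (Y b)"])
    fix v :: "nat \<Rightarrow> nat \<Rightarrow> complex"
    show "0 \<le> Re (\<Sum>a<2. \<Sum>b<2. qform d (v a) (ketbra d (Y a) (Y b)) (v b))"
      by (rule qform_ketbra_blocks_nonneg)
  qed (use that in \<open>auto simp: ketbra_def\<close>)
  then have "qform d w (\<Phi> (ketbra d z y)) x = cnj (qform d x (\<Phi> (ketbra d y z)) w)"
    by (intro qform_adjoint) (simp add: Y_def)
  then show ?thesis by (simp add: choi_def)
qed

text \<open>The sum is the trace of the image of the projection on \<open>f j\<close>.\<close>

lemma choi_column_sum:
  assumes f: "orthonormal d d f" and j: "j < d"
  shows "(\<Sum>i<d. choi (f i) (f j) (f i) (f j)) = 1"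
proof -
  have "(\<Sum>i<d. choi (f i) (f j) (f i) (f j)) = mat_trace (\<Phi> (ketbra d (f j) (f j)))"
    unfolding choi_def by (intro mat_trace_orthonormal_basis f superop_carrier) simp
  also have "\<dots> = mat_trace (ketbra d (f j) (f j))"
    using trace_preserving unfolding trace_preserving_def by simp
  also have "\<dots> = cinner d (f j) (f j)" by (simp add: mat_trace_def ketbra_def cinner_def mult.commute)
  finally show ?thesis using f j by (simp add: orthonormal_def)
qed

text \<open>The identity is the sum of the projections on the \<open>f j\<close>.\<close>

lemma qform_superop_one:
  assumes f: "orthonormal d d f"
  shows "qform d x (\<Phi> (1\<^sub>m d)) w = (\<Sum>j<d. choi x (f j) w (f j))"
proof -
  have "(\<Sum>j<d. choi x (f j) w (f j)) = (\<Sum>a<d. qform d x (\<Phi> (matrix_unit d a a)) w)"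
    unfolding choi_eq_sum by (rule sum_orthonormal_basis[OF f])
  also have "\<dots> = (\<Sum>a<d. \<Sum>b<d. if b = a then qform d x (\<Phi> (matrix_unit d a a)) w else 0)"
    by simp
  also have "\<dots> = qform d x (\<Phi> (1\<^sub>m d)) w"
    unfolding qform_superop[OF one_carrier_mat] by (intro sum.cong refl) auto
  finally show ?thesis by simp
qed

text \<open>The matrices \<open>ketbra d (f i) (f j)\<close> form an orthonormal basis of the matrix
  space, and the summands are the diagonal coefficients of \<Phi> in it. Completeness is applied
  twice, once for i and once for j.\<close>

lemma superop_trace_orthonormal_basis:
  assumes f: "orthonormal d d f"
  shows "superop_trace d \<Phi> = (\<Sum>i<d. \<Sum>j<d. choi (f i) (f i) (f j) (f j))"
proof -
  let ?E = "\<lambda>a b k l. \<Phi> (matrix_unit d a b) $$ (k, l)"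
  let ?K = "\<lambda>j a k. \<Sum>l<d. \<Sum>b<d. f j l * cnj (f j b) * ?E a b k l"
  have choi: "choi (f i) (f i) (f j) (f j) = (\<Sum>a<d. \<Sum>k<d. f i a * cnj (f i k) * ?K j a k)" for i j
  proof -
    let ?t = "\<lambda>a b k l. f i a * cnj (f i k) * (f j l * cnj (f j b) * ?E a b k l)"
    have "choi (f i) (f i) (f j) (f j) = (\<Sum>a<d. \<Sum>b<d. \<Sum>k<d. \<Sum>l<d. ?t a b k l)"
      unfolding choi_eq_sum qform_eq_sum
      by (intro sum.cong refl) (simp add: sum_distrib_left mult_ac)
    also have "\<dots> = (\<Sum>a<d. \<Sum>k<d. \<Sum>b<d. \<Sum>l<d. ?t a b k l)"
      by (rule sum.cong[OF refl], rule sum.swap)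
    also have "\<dots> = (\<Sum>a<d. \<Sum>k<d. \<Sum>l<d. \<Sum>b<d. ?t a b k l)"
      by (rule sum.cong[OF refl], rule sum.cong[OF refl], rule sum.swap)
    finally show ?thesis by (simp add: sum_distrib_left)
  qed
  have "(\<Sum>i<d. \<Sum>j<d. choi (f i) (f i) (f j) (f j)) = (\<Sum>j<d. \<Sum>i<d. choi (f i) (f i) (f j) (f j))"
    by (rule sum.swap)
  also have "\<dots> = (\<Sum>j<d. \<Sum>a<d. ?K j a a)"
    unfolding choi sum_orthonormal_basis[OF f] ..
  also have "\<dots> = (\<Sum>a<d. \<Sum>j<d. ?K j a a)" by (rule sum.swap)
  also have "\<dots> = (\<Sum>a<d. \<Sum>b<d. ?E a b a b)"
    unfolding sum_orthonormal_basis[OF f] ..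
  finally show ?thesis by (simp add: superop_trace_def)
qed

text \<open>The Choi form is tested on x x^* - y y^*; \<open>lincomb (- 1) y 0 y\<close> is the
  vector -y.\<close>

lemma choi_diagonal_pair:
  "Re (choi x x y y) + Re (choi y y x x) \<le> Re (choi x x x x) + Re (choi y y y y)"
  using choi_two_positive[of x x y "lincomb (- 1) y 0 y"] by (simp add: choi_lincomb)

text \<open>2-positivity only tests matrices of rank two, but the diagonal part $xx^* + yy^* - 2zz^*$ has
  rank three. It is completed to the rank two matrix
  $xx^* + (y-\omega z)(y+\omega z)^*$ with $|\omega|^2 = 2$, and averaging over $\omega$ removes all
  cross terms except those contributing the last summand.\<close>

lemma choi_diagonal_triple:
  "0 \<le> Re (choi x x x x) + Re (choi y y y y) + 4 * Re (choi z z z z)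
     + Re (choi x x y y) + Re (choi y y x x)
     - 2 * (Re (choi x x z z) + Re (choi z z x x) + Re (choi y y z z) + Re (choi z z y y))
     + 2 * (Re (choi y z y z) + Re (choi z y z y))"
proof -
  define G where "G \<omega> = choi x x x x + choi x x (lincomb 1 y (- \<omega>) z) (lincomb 1 y \<omega> z)
      + choi (lincomb 1 y (- \<omega>) z) (lincomb 1 y \<omega> z) x x
      + choi (lincomb 1 y (- \<omega>) z) (lincomb 1 y \<omega> z) (lincomb 1 y (- \<omega>) z) (lincomb 1 y \<omega> z)"
    for \<omega>
  define t where "t = complex_of_real (sqrt 2)"
  have t: "t * t = 2" "cnj t = t" by (simp_all add: t_def flip: of_real_mult)
  have t': "t * (t * a) = 2 * a" for a using t(1) by (simp add: mult.assoc[symmetric])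
  \<comment> \<open>Adding the values at \<omega> and -\<omega> removes all terms of odd total
    degree in \<omega> and its conjugate.\<close>
  have even: "G \<omega> + G (- \<omega>) = 2 * (choi x x x x + choi y y y y + choi x x y y + choi y y x x
      - \<omega> * cnj \<omega> * (choi x x z z + choi z z x x + choi y y z z + choi z z y y)
      + \<omega> * cnj \<omega> * (choi y z y z + choi z y z y)
      + (\<omega> * cnj \<omega>)\<^sup>2 * choi z z z z - \<omega>\<^sup>2 * choi y z z y - (cnj \<omega>)\<^sup>2 * choi z y y z)" for \<omega>
    unfolding G_def by (simp add: choi_lincomb algebra_simps power2_eq_square)
  \<comment> \<open>At t and i t the squared modulus is 2, while the squares are 2 and -2, so the
    terms with \<omega>^2 and its conjugate cancel.\<close>
  have "G t + G (- t) + (G (\<i> * t) + G (- (\<i> * t)))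
      = 4 * (choi x x x x + choi y y y y + 4 * choi z z z z + choi x x y y + choi y y x x
     - 2 * (choi x x z z + choi z z x x + choi y y z z + choi z z y y)
     + 2 * (choi y z y z + choi z y z y))"
    unfolding even by (simp add: t t' power2_eq_square algebra_simps)
  moreover have "0 \<le> Re (G \<omega>)" for \<omega> unfolding G_def by (rule choi_two_positive)
  then have "0 \<le> Re (G t + G (- t) + (G (\<i> * t) + G (- (\<i> * t))))"
    by (simp only: plus_complex.sel add_nonneg_nonneg)
  ultimately show ?thesis by simp
qed

end

text \<open>Since X maps v to u and its adjoint maps u to v, X - u v^* is X compressed by the
  projections 1 - u u^* and 1 - v v^*. With a', b' the projected vectors, contractivity makes the
  sum at least |a' + X b'|^2.\<close>

lemma contraction_block_nonneg:
  assumes X: "X \<in> carrier_mat d d"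
    and contr: "\<And>y. sqnorm d (mat_app d X y) \<le> sqnorm d y"
    and u: "sqnorm d u = 1" and v: "sqnorm d v = 1"
    and Xv: "\<And>k. k < d \<Longrightarrow> mat_app d X v k = u k"
    and Xu: "\<And>k. k < d \<Longrightarrow> adj_app d X u k = v k"
  shows "0 \<le> Re (qform d a (1\<^sub>m d - ketbra d u u) a) + Re (qform d b (1\<^sub>m d - ketbra d v v) b)
    + 2 * Re (qform d a (X - ketbra d u v) b)"
proof -
  define \<alpha> \<beta> where "\<alpha> = cinner d u a" and "\<beta> = cinner d v b"
  define a' b' where "a' = lincomb 1 a (- \<alpha>) u" and "b' = lincomb 1 b (- \<beta>) v"
  have c\<alpha>: "cinner d a u = cnj \<alpha>" and c\<beta>: "cinner d b v = cnj \<beta>"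
    by (simp_all add: \<alpha>_def \<beta>_def cnj_cinner)
  have sa: "sqnorm d a' = Re (qform d a (1\<^sub>m d - ketbra d u u) a)"
    by (simp add: a'_def sqnorm_lincomb u qform_minus qform_one qform_ketbra cinner_self c\<alpha>
        flip: \<alpha>_def) (simp add: cmod_power2 flip: power2_eq_square)
  have sb: "sqnorm d b' = Re (qform d b (1\<^sub>m d - ketbra d v v) b)"
    by (simp add: b'_def sqnorm_lincomb v qform_minus qform_one qform_ketbra cinner_self c\<beta>
        flip: \<beta>_def) (simp add: cmod_power2 flip: power2_eq_square)
  have "qform d x X v = cinner d x u" for x
    unfolding qform_def by (rule cinner_cong) (auto simp: Xv)
  then have q1: "qform d a X v = cnj \<alpha>" "qform d u X v = 1"
    by (simp_all add: c\<alpha> cinner_self u)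
  have "qform d u X b = cinner d v b"
    unfolding qform_def cinner_mat_app by (rule cinner_cong) (auto simp: Xu)
  then have q2: "qform d u X b = \<beta>" by (simp add: \<beta>_def)
  have ab: "cinner d a' (mat_app d X b') = qform d a (X - ketbra d u v) b"
  proof -
    have "cinner d a' (mat_app d X b') = qform d a' X b'" by (simp add: qform_def)
    also have "\<dots> = qform d a X b - cnj \<alpha> * \<beta>"
      by (simp add: a'_def b'_def qform_lincomb_left qform_lincomb_right q1 q2 algebra_simps)
    also have "\<dots> = qform d a (X - ketbra d u v) b"
      using X by (simp add: qform_minus qform_ketbra c\<alpha> \<beta>_def)
    finally show ?thesis .
  qed
  have "0 \<le> sqnorm d (lincomb 1 a' 1 (mat_app d X b'))" by (rule sqnorm_nonneg)
  also have "\<dots> = sqnorm d a' + sqnorm d (mat_app d X b') + 2 * Re (qform d a (X - ketbra d u v) b)"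
    by (simp add: sqnorm_lincomb ab)
  finally show ?thesis using contr[of b'] sa sb by simp
qed

section \<open>The eigenvalue bound and the trace bound\<close>

context two_positive_channel
begin

lemma qform_superop_minus:
  assumes "A \<in> carrier_mat d d" "B \<in> carrier_mat d d"
  shows "qform d x (\<Phi> (A - B)) w = qform d x (\<Phi> A) w - qform d x (\<Phi> B) w"
proof -
  have "A - B \<in> carrier_mat d d" using assms(2) by (rule minus_carrier_mat)
  then show ?thesis
    using assms by (simp add: qform_superop algebra_simps sum_subtractf)
qed

lemma eigenvalue_lower_bound:
  assumes X: "X \<in> carrier_mat d d" and eigen: "\<Phi> X = \<mu> \<cdot>\<^sub>m X"
    and contr: "\<And>y. sqnorm d (mat_app d X y) \<le> sqnorm d y"
    and u: "sqnorm d u = 1" and v: "sqnorm d v = 1"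
    and Xv: "\<And>k. k < d \<Longrightarrow> mat_app d X v k = u k"
    and Xu: "\<And>k. k < d \<Longrightarrow> adj_app d X u k = v k"
  shows "Re (choi u u v v) + (Re (choi u u u u) + Re (choi v v v v)) / 2
    - (Re (qform d u (\<Phi> (1\<^sub>m d)) u) + Re (qform d v (\<Phi> (1\<^sub>m d)) v)) / 2 \<le> Re \<mu>"
proof -
  define P Q R R' where "P = 1\<^sub>m d - ketbra d u u" and "Q = 1\<^sub>m d - ketbra d v v"
    and "R = X - ketbra d u v" and "R' = mat d d (\<lambda>(i, j). cnj (R $$ (j, i)))"
  have PQR: "P \<in> carrier_mat d d" "Q \<in> carrier_mat d d" "R \<in> carrier_mat d d" "R' \<in> carrier_mat d d"
    using X by (auto simp: P_def Q_def R_def R'_def minus_carrier_mat)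
  define B where "B a b = (if a = 0 then if b = 0 then P else R else if b = 0 then R' else Q)"
    for a b :: nat
  have B: "B 0 0 = P" "B 0 1 = R" "B 1 0 = R'" "B 1 1 = Q" by (simp_all add: B_def)
  have R': "R' $$ (i, j) = cnj (R $$ (j, i))" if "i < d" "j < d" for i j
    using that by (simp add: R'_def)
  have sum2: "(\<Sum>a<2. \<Sum>b<2. g a b) = g 0 0 + g 0 1 + (g 1 0 + g 1 1)" for g :: "nat \<Rightarrow> nat \<Rightarrow> complex"
    by (simp add: numeral_2_eq_2)
  have carr: "B a b \<in> carrier_mat d d" for a b using PQR by (auto simp: B_def)
  have herm: "B a b $$ (i, j) = cnj (B b a $$ (j, i))" if "i < d" "j < d" for a b i j
    using that by (auto simp: B_def P_def Q_def ketbra_def R')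
  have pos: "0 \<le> Re (\<Sum>a<2. \<Sum>b<2. qform d (x a) (B a b) (x b))" for x
  proof -
    have "qform d (x 1) R' (x 0) = cnj (qform d (x 0) R (x 1))"
      by (rule qform_adjoint) (rule R')
    then show ?thesis
      using contraction_block_nonneg[OF X contr u v Xv Xu, of "x 0" "x 1"]
      unfolding sum2 B by (simp add: P_def Q_def R_def)
  qed
  note tp = two_positive_blocks[of B, OF carr herm pos]
  have "\<Phi> R' $$ (i, j) = cnj (\<Phi> R $$ (j, i))" if "i < d" "j < d" for i j
    using tp(1)[of 1 0 i j] that unfolding B by simp
  then have adj: "qform d v (\<Phi> R') u = cnj (qform d u (\<Phi> R) v)" by (rule qform_adjoint)
  have "0 \<le> Re (qform d u (\<Phi> P) u) + Re (qform d v (\<Phi> Q) v) + 2 * Re (qform d u (\<Phi> R) v)"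
    using tp(2)[of "\<lambda>a. if a = 0 then u else v"] unfolding sum2 B by (simp add: adj)
  \<comment> \<open>The eigenvalue enters here: u^* \<Phi>(X) v = \<mu> u^* X v, and u^* X v = |u|^2
    = 1.\<close>
  moreover have "qform d u (\<Phi> R) v = \<mu> - choi u u v v"
  proof -
    have "qform d u (\<Phi> X) v = (\<Sum>i<d. \<Sum>j<d. \<mu> * (cnj (u i) * X $$ (i, j) * v j))"
      unfolding eigen qform_eq_sum using X by (intro sum.cong refl) simp
    also have "\<dots> = \<mu> * qform d u X v" by (simp add: qform_eq_sum sum_distrib_left)
    also have "qform d u X v = cinner d u u"
      unfolding qform_def by (rule cinner_cong) (auto simp: Xv)
    finally have "qform d u (\<Phi> X) v = \<mu>" by (simp add: cinner_self u)
    then show ?thesis using X by (simp add: R_def qform_superop_minus choi_def)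
  qed
  ultimately show ?thesis
    by (simp add: P_def Q_def qform_superop_minus field_simps flip: choi_def)
qed

lemma superop_trace_bound:
  assumes d: "2 \<le> d" and X: "X \<in> carrier_mat d d" "X \<noteq> 0\<^sub>m d d" and eigen: "\<Phi> X = \<mu> \<cdot>\<^sub>m X"
  shows "Re (superop_trace d \<Phi>) \<le> real d * Re \<mu> + ((real d)\<^sup>2 - real d)"
proof -
  obtain \<alpha> u v \<rho> where contr: "\<And>y. sqnorm d (mat_app d (\<alpha> \<cdot>\<^sub>m X) y) \<le> sqnorm d y"
    and uv: "sqnorm d u = 1" "sqnorm d v = 1"
    and Xv: "\<And>k. k < d \<Longrightarrow> mat_app d (\<alpha> \<cdot>\<^sub>m X) v k = u k"
    and Xu: "\<And>k. k < d \<Longrightarrow> adj_app d (\<alpha> \<cdot>\<^sub>m X) u k = v k"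
    and \<rho>: "0 \<le> \<rho>" "cinner d u v = of_real \<rho>"
    using exists_top_singular_pair[OF X] by metis
  define Y where "Y = \<alpha> \<cdot>\<^sub>m X"
  have Y: "Y \<in> carrier_mat d d" using X by (simp add: Y_def)
  have eigenY: "\<Phi> Y = \<mu> \<cdot>\<^sub>m Y"
    unfolding Y_def superop_smult[OF X(1)] eigen using X by (intro eq_matI) auto
  obtain f and c s :: real where f: "orthonormal d d f" and cs: "0 \<le> c" "0 \<le> s" "c\<^sup>2 + s\<^sup>2 = 1" "s\<^sup>2 \<le> 1 / 2"
    and ue: "\<And>i. i < d \<Longrightarrow> u i = lincomb c (f 0) s (f 1) i"
    and ve: "\<And>i. i < d \<Longrightarrow> v i = lincomb c (f 0) (- s) (f 1) i"
    using symmetric_pair_basis[OF d uv \<rho>(2,1)] by metis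
  \<comment> \<open>u and v are known to agree with these combinations only below d; the replacement
    makes the expansion rules for \<open>lincomb\<close> applicable.\<close>
  define u' v' where "u' = lincomb c (f 0) s (f 1)" and "v' = lincomb c (f 0) (- s) (f 1)"
  have norms: "sqnorm d u' = 1" "sqnorm d v' = 1"
    using uv sqnorm_cong[of d u u'] sqnorm_cong[of d v v'] ue ve by (auto simp: u'_def v'_def)
  have Xv': "mat_app d Y v' k = u' k" if "k < d" for k
  proof -
    have "mat_app d Y v' k = mat_app d Y v k"
      unfolding mat_app_def by (rule sum.cong) (auto simp: ve v'_def)
    then show ?thesis using Xv ue that by (simp add: Y_def u'_def)
  qed
  have Xu': "adj_app d Y u' k = v' k" if "k < d" for k
  proof -
    have "adj_app d Y u' k = adj_app d Y u k"
      unfolding adj_app_def by (rule sum.cong) (auto simp: ue u'_def)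
    then show ?thesis using Xu ve that by (simp add: Y_def v'_def)
  qed
  define p q where "p i j = Re (choi (f i) (f j) (f i) (f j))"
    and "q i j = Re (choi (f i) (f i) (f j) (f j))" for i j
  define C S where "C = c\<^sup>2" and "S = s\<^sup>2"
  have low: "Re (choi u' u' v' v') + (Re (choi u' u' u' u') + Re (choi v' v' v' v')) / 2
      - (Re (qform d u' (\<Phi> (1\<^sub>m d)) u') + Re (qform d v' (\<Phi> (1\<^sub>m d)) v')) / 2 \<le> Re \<mu>"
    by (rule eigenvalue_lower_bound[OF Y eigenY _ norms Xv' Xu'])
      (use contr in \<open>simp add: Y_def\<close>)
  \<comment> \<open>The left side is the Choi form at u' u'^* + v' v'^*, which is twice c^2 f0 f0^*
    + s^2 f1 f1^*; the mixed terms cancel by the opposite signs of s.\<close>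
  have "choi u' u' v' v' + choi v' v' u' u' + choi u' u' u' u' + choi v' v' v' v'
      = 4 * (of_real c ^ 4 * choi (f 0) (f 0) (f 0) (f 0) + of_real s ^ 4 * choi (f 1) (f 1) (f 1) (f 1)
        + (of_real c)\<^sup>2 * (of_real s)\<^sup>2 * (choi (f 0) (f 0) (f 1) (f 1) + choi (f 1) (f 1) (f 0) (f 0)))"
    unfolding u'_def v'_def
    by (simp add: choi_lincomb algebra_simps power2_eq_square power4_eq_xxxx)
  then have "Re (choi u' u' v' v' + choi v' v' u' u' + choi u' u' u' u' + choi v' v' v' v')
      = 4 * (C\<^sup>2 * q 0 0 + S\<^sup>2 * q 1 1 + C * S * (q 0 1 + q 1 0))"
    by (simp only:) (simp add: q_def C_def S_def flip: of_real_power of_real_mult power_mult)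
  \<comment> \<open>So the one mixed term of the eigenvalue bound is half of the symmetric pair just
    computed.\<close>
  moreover have "Re (choi v' v' u' u') = Re (choi u' u' v' v')"
    using cnj_choi[of u' u' v' v'] by (metis complex_cnj_cancel_iff complex.sel(1) cnj.sel(1))
  ultimately have quad: "Re (choi u' u' v' v') + (Re (choi u' u' u' u') + Re (choi v' v' v' v')) / 2
      = 2 * C\<^sup>2 * q 0 0 + 2 * S\<^sup>2 * q 1 1 + 2 * C * S * (q 0 1 + q 1 0)"
    by (simp add: field_simps)
  \<comment> \<open>The terms mixing \<open>f 0\<close> and \<open>f 1\<close> cancel by the same
    choice of signs.\<close>
  have "qform d u' (\<Phi> (1\<^sub>m d)) u' + qform d v' (\<Phi> (1\<^sub>m d)) v'
      = 2 * ((of_real c)\<^sup>2 * qform d (f 0) (\<Phi> (1\<^sub>m d)) (f 0) + (of_real s)\<^sup>2 * qform d (f 1) (\<Phi> (1\<^sub>m d)) (f 1))"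
    unfolding u'_def v'_def
    by (simp add: qform_lincomb_left qform_lincomb_right algebra_simps power2_eq_square)
  then have "Re (qform d u' (\<Phi> (1\<^sub>m d)) u' + qform d v' (\<Phi> (1\<^sub>m d)) v')
      = 2 * (C * (\<Sum>j<d. p 0 j) + S * (\<Sum>j<d. p 1 j))"
    by (simp only: qform_superop_one[OF f])
      (simp add: p_def C_def S_def flip: of_real_power)
  with low quad have low': "2 * C\<^sup>2 * q 0 0 + 2 * S\<^sup>2 * q 1 1 + 2 * C * S * (q 0 1 + q 1 0)
      - C * (\<Sum>j<d. p 0 j) - S * (\<Sum>j<d. p 1 j) \<le> Re \<mu>"
    by (simp add: add_divide_distrib)
  have "Re (superop_trace d \<Phi>) = (\<Sum>i<d. \<Sum>j<d. q i j)"
    by (simp add: superop_trace_orthonormal_basis[OF f] q_def)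
  also have "\<dots> \<le> (real d)\<^sup>2 - real d
    + real d * (2 * C\<^sup>2 * q 0 0 + 2 * S\<^sup>2 * q 1 1 + 2 * C * S * (q 0 1 + q 1 0)
        - C * (\<Sum>j<d. p 0 j) - S * (\<Sum>j<d. p 1 j))"
  proof (rule trace_inequality_coefficients[OF d])
    show "(\<Sum>i<d. p i j) = 1" if "j < d" for j
      using arg_cong[OF choi_column_sum[OF f that], of Re] by (simp add: p_def)
    show "0 \<le> q 0 0 + q 1 1 + 4 * q j j + q 0 1 + q 1 0 - 2 * (q 0 j + q j 0 + q 1 j + q j 1)
        + 2 * (p 1 j + p j 1)" for j
      unfolding p_def q_def by (rule choi_diagonal_triple)
  qed (use cs in \<open>auto simp: p_def q_def C_def S_def choi_nonneg intro: choi_diagonal_pair\<close>)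
  also have "\<dots> \<le> (real d)\<^sup>2 - real d + real d * Re \<mu>"
    using low' by (intro add_left_mono mult_left_mono) auto
  finally show ?thesis by simp
qed

end

section \<open>The spectrum\<close>

definition vec_of_mat :: "nat \<Rightarrow> complex mat \<Rightarrow> complex vec" where
  "vec_of_mat d X = vec (d * d) (\<lambda>p. X $$ (p div d, p mod d))"

text \<open>The matrix of \<Phi> in the basis of matrix units listed row by row; it transfers
  results on spectra of matrices to \<Phi>.\<close>

definition superop_matrix :: "nat \<Rightarrow> (complex mat \<Rightarrow> complex mat) \<Rightarrow> complex mat" where
  "superop_matrix d \<Phi> = mat (d * d) (d * d)
     (\<lambda>(p, q). \<Phi> (matrix_unit d (q div d) (q mod d)) $$ (p div d, p mod d))"

lemma div_mod_less: "p < d * d \<Longrightarrow> p div d < d \<and> p mod d < (d::nat)"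
  by (cases "d = 0") (auto simp: less_mult_imp_div_less)

lemma vec_of_mat_eq_iff:
  assumes "X \<in> carrier_mat d d" "Y \<in> carrier_mat d d"
  shows "vec_of_mat d X = vec_of_mat d Y \<longleftrightarrow> X = Y"
proof
  assume eq: "vec_of_mat d X = vec_of_mat d Y"
  have "X $$ (i, j) = Y $$ (i, j)" if "i < d" "j < d" for i j
    using arg_cong[OF eq, of "\<lambda>v. v $ (i * d + j)"] that
    by (simp add: vec_of_mat_def block_index_less)
  then show "X = Y" using assms by (intro eq_matI) auto
qed simp

lemma vec_of_mat_smult:
  "X \<in> carrier_mat d d \<Longrightarrow> vec_of_mat d (\<mu> \<cdot>\<^sub>m X) = \<mu> \<cdot>\<^sub>v vec_of_mat d X"
  by (intro eq_vecI) (auto simp: vec_of_mat_def div_mod_less)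

lemma vec_of_mat_zero: "vec_of_mat d (0\<^sub>m d d) = 0\<^sub>v (d * d)"
  by (intro eq_vecI) (auto simp: vec_of_mat_def div_mod_less)

context two_positive_channel
begin

lemma superop_matrix_mult_vec:
  assumes X: "X \<in> carrier_mat d d"
  shows "superop_matrix d \<Phi> *\<^sub>v vec_of_mat d X = vec_of_mat d (\<Phi> X)"
proof (intro eq_vecI)
  fix p assume "p < dim_vec (vec_of_mat d (\<Phi> X))"
  then have p: "p < d * d" by (simp add: vec_of_mat_def)
  have "(superop_matrix d \<Phi> *\<^sub>v vec_of_mat d X) $ p
      = (\<Sum>q<d * d. superop_matrix d \<Phi> $$ (p, q) * vec_of_mat d X $ q)"
    using p by (simp add: superop_matrix_def vec_of_mat_def scalar_prod_def atLeast0LessThan)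
  also have "\<dots> = (\<Sum>a<d. \<Sum>b<d. X $$ (a, b) * \<Phi> (matrix_unit d a b) $$ (p div d, p mod d))"
    unfolding sum_blocks using p
    by (intro sum.cong refl) (simp add: superop_matrix_def vec_of_mat_def block_index_less)
  also have "\<dots> = vec_of_mat d (\<Phi> X) $ p"
    using p div_mod_less[OF p] superop_index[OF X, of "p div d" "p mod d"] by (simp add: vec_of_mat_def)
  finally show "(superop_matrix d \<Phi> *\<^sub>v vec_of_mat d X) $ p = vec_of_mat d (\<Phi> X) $ p" .
qed (simp add: superop_matrix_def vec_of_mat_def)

text \<open>\<open>vec_of_mat d\<close> is a linear bijection onto the vectors of length
  \<open>d * d\<close> that intertwines \<Phi> with its matrix, so eigenvectors correspond.\<close>

lemma superop_spectrum_eq: "superop_spectrum d \<Phi> = spectrum (superop_matrix d \<Phi>)"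
proof -
  have eigen: "eigenvector (superop_matrix d \<Phi>) (vec_of_mat d X) \<mu> \<longleftrightarrow> X \<noteq> 0\<^sub>m d d \<and> \<Phi> X = \<mu> \<cdot>\<^sub>m X"
    if X: "X \<in> carrier_mat d d" for X \<mu>
  proof -
    have "\<mu> \<cdot>\<^sub>m X \<in> carrier_mat d d" "dim_row (superop_matrix d \<Phi>) = d * d"
      "vec_of_mat d X \<in> carrier_vec (d * d)"
      using X by (auto simp: superop_matrix_def vec_of_mat_def)
    then show ?thesis
      unfolding eigenvector_def superop_matrix_mult_vec[OF X] vec_of_mat_smult[OF X, symmetric]
      using X superop_carrier[OF X]
      by (simp add: vec_of_mat_eq_iff vec_of_mat_zero[symmetric])
  qed
  have "\<exists>X \<in> carrier_mat d d. v = vec_of_mat d X" if "v \<in> carrier_vec (d * d)" for v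
    using that
    by (intro bexI[of _ "mat d d (\<lambda>(i, j). v $ (i * d + j))"] eq_vecI)
      (auto simp: vec_of_mat_def div_mod_less)
  moreover have "v \<in> carrier_vec (d * d)" if "eigenvector (superop_matrix d \<Phi>) v \<mu>" for v \<mu>
    using that by (simp add: eigenvector_def superop_matrix_def)
  ultimately show ?thesis
    unfolding superop_spectrum_def spectrum_def eigenvalue_def using eigen by blast
qed

text \<open>Ensures that the \<open>Min\<close> over the spectrum is an attained value.\<close>

lemma superop_spectrum_finite_nonempty:
  assumes "1 \<le> d"
  shows "finite (superop_spectrum d \<Phi>)" "superop_spectrum d \<Phi> \<noteq> {}"
proof -
  have N: "superop_matrix d \<Phi> \<in> carrier_mat (d * d) (d * d)" by (simp add: superop_matrix_def)
  show "finite (superop_spectrum d \<Phi>)"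
    unfolding superop_spectrum_eq by (rule card_finite_spectrum[OF N])
  show "superop_spectrum d \<Phi> \<noteq> {}"
    unfolding superop_spectrum_eq using assms by (intro spectrum_non_empty[OF N]) simp
qed

text \<open>For d = 1 there is no second basis vector to extend to. Trace preservation then makes
  \<Phi> the identity, and both sides are 1.\<close>

lemma superop_trace_dim_one:
  assumes d: "d = 1" and X: "X \<in> carrier_mat d d" "X \<noteq> 0\<^sub>m d d" and eigen: "\<Phi> X = \<mu> \<cdot>\<^sub>m X"
  shows "Re (superop_trace d \<Phi>) = Re \<mu>"
proof -
  have tr: "\<Phi> A $$ (0, 0) = A $$ (0, 0)" if "A \<in> carrier_mat d d" for A
    using trace_preserving that superop_carrier[OF that]
    by (auto simp: trace_preserving_def mat_trace_def d)
  have X0: "X $$ (0, 0) \<noteq> 0"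
    using X d by (auto intro: eq_matI)
  have "\<mu> * X $$ (0, 0) = X $$ (0, 0)" using tr[OF X(1)] X(1) d unfolding eigen by simp
  then have "\<mu> = 1" using X0 by simp
  moreover have "superop_trace d \<Phi> = 1"
    using tr[of "matrix_unit d 0 0"] by (simp add: superop_trace_def d matrix_unit_def)
  ultimately show ?thesis by simp
qed

end

theorem theorem1:
  fixes d :: nat and \<Phi> :: "complex mat \<Rightarrow> complex mat"
  assumes "d \<ge> 1"
    and "linear_superop d \<Phi>"
    and "two_positive d \<Phi>"
    and "trace_preserving d \<Phi>"
  shows "Re (superop_trace d \<Phi>)
           \<le> real d * Min (Re ` superop_spectrum d \<Phi>) + ((real d)\<^sup>2 - real d)"
proof -
  interpret two_positive_channel d \<Phi> using assms by unfold_locales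
  \<comment> \<open>The minimum is the real part of some eigenvalue, so a bound for an arbitrary
    eigenvector suffices.\<close>
  have "Min (Re ` superop_spectrum d \<Phi>) \<in> Re ` superop_spectrum d \<Phi>"
    using superop_spectrum_finite_nonempty[OF assms(1)] by (intro Min_in) auto
  then obtain \<mu> X where min: "Min (Re ` superop_spectrum d \<Phi>) = Re \<mu>"
    and X: "X \<in> carrier_mat d d" "X \<noteq> 0\<^sub>m d d" "\<Phi> X = \<mu> \<cdot>\<^sub>m X"
    unfolding superop_spectrum_def by auto
  show ?thesis
  proof (cases "d = 1")
    case True
    then show ?thesis unfolding min superop_trace_dim_one[OF True X] by simp
  next
    case False
    then have "2 \<le> d" using assms(1) by simp
    then show ?thesis unfolding min by (rule superop_trace_bound[OF _ X])
  qed
qed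

end
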